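(* Let $T>0$, $N\ge 2$ an integer, $\tau=T/N$ (with no further restriction on $\tau$). For any sequence write $\boldsymbol{v}_n^\star:=2\boldsymbol{v}_n-\boldsymbol{v}_{n-1}$. Let $(\rho_n)_{n=0}^N$, $(\boldsymbol{u}_n)_{n=0}^N$, $(p_n)_{n=1}^N$ satisfy, for $n=1,\dots,N-1$, the second-order coupled IMEX scheme in $\Omega$ $$\frac{3\rho_{n+1}-4\rho_n+\rho_{n-1}}{2\tau} + \boldsymbol{u}^{\star}_n\cdot\nabla\rho_{n+1} + \frac{\nabla\cdot\boldsymbol{u}^{\star}_{n}}{2}\rho_{n+1} = 0,$$ $$\frac{\sqrt{\rho_{n+1}}}{2\tau}\big(3\sqrt{\rho_{n+1}}\,\boldsymbol{u}_{n+1}-4\sqrt{\rho_{n}}\,\boldsymbol{u}_{n} + \sqrt{\rho_{n-1}}\,\boldsymbol{u}_{n-1}\big) + (\rho_{n+1}\nabla\boldsymbol{u}_{n+1})\boldsymbol{u}_n^{\star} + \tfrac{1}{2}[\nabla\cdot(\rho_{n+1}\boldsymbol{u}_n^{\star})]\boldsymbol{u}_{n+1} -\nabla\cdot(\mu_{n+1}\nabla\boldsymbol{u}_{n+1}) + \nabla p_{n+1} = \nabla^{\top}\boldsymbol{u}_{n}^{\star}\nabla\mu_{n+1} + \boldsymbol{f}_{n+1},$$ $$\nabla\cdot\boldsymbol{u}_{n+1} = 0,$$ with $\boldsymbol{u}_{n+1}=\boldsymbol{0}$ on $\partial\Omega$, where $(\rho_1,\boldsymbol{u}_1,p_1)$ is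 computed from $(\rho_0,\boldsymbol{u}_0)$ by one step of the first-order scheme recalled in the context, under the standing assumptions given in the context. Then, for all positive constants $\varepsilon,\epsilon$ with $10\varepsilon+\epsilon\le 1$, $$\begin{aligned}&\big\|\sqrt{\rho_N}\,\boldsymbol{u}_{N}\big\|^2 + \big\|2\sqrt{\rho_N}\,\boldsymbol{u}_{N}-\sqrt{\rho_{N-1}}\,\boldsymbol{u}_{N-1}\big\|^2 + 40\tau\varepsilon\big\|\sqrt{\mu_N}\,\nabla\boldsymbol{u}_{N}\big\|^2\\ &+ 4\tau(1-\epsilon-10\varepsilon)\sum_{n=1}^{N}\big\|\sqrt{\mu_{n}}\,\nabla\boldsymbol{u}_{n}\big\|^2 + 4\tau\varepsilon\mu_{\mathrm{min}}\sum_{n=2}^{N}\big\|2\nabla\boldsymbol{u}_{n-1}+\nabla\boldsymbol{u}_{n-2}\big\|^2\\ &\le \left(\tilde{C} + \sum_{n=1}^{N}\frac{\tau}{\epsilon\mu_{\mathrm{min}}}\|\boldsymbol{f}_{n}\|_{-1}^2\right)\exp\left(\frac{T\|\nabla\mu\|_{\infty}^2}{\varepsilon\varrho_{\mathrm{min}}\mu_{\mathrm{min}}}\right),\end{aligned}$$ where $\tilde C$ is a positive constant depending only on the initial conditions, on the problem data and on $\tau$, and which does not grow with decreasing $\tau$ (i.e. $\partial_\tau \tilde C\ge 0$ for all $\tau>0$).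
   Context: Setting: $\Omega\subset\mathbb{R}^d$, $d\in\{2,3\}$, is a domain, $Q=\Omega\times(0,T]$. The scheme is a time discretisation (continuous in space) of the incompressible Navier--Stokes equations with variable density $\rho>0$ and variable dynamic viscosity $\mu$, velocity $\boldsymbol{u}$, pressure $p$, body force $\boldsymbol{f}$. A subscript $n$ denotes the approximation (or the given value) at time $t_n=n\tau$. Initialisation (first-order step, $n=0$): $$\frac{\rho_{1}-\rho_0}{\tau} + \boldsymbol{u}_0\cdot\nabla\rho_{1} + \frac{\nabla\cdot\boldsymbol{u}_{0}}{2}\rho_{1} = 0,$$ $$\frac{\sqrt{\rho_{1}}}{\tau}\big(\sqrt{\rho_{1}}\,\boldsymbol{u}_{1}-\sqrt{\rho_0}\,\boldsymbol{u}_{0}\big) + (\rho_{1}\nabla\boldsymbol{u}_{1})\boldsymbol{u}_0 + \tfrac{1}{2}[\nabla\cdot(\rho_{1}\boldsymbol{u}_0)]\boldsymbol{u}_{1} -\nabla\cdot(\mu_{1}\nabla\boldsymbol{u}_{1}) + \nabla p_{1} = \nabla^{\top}\boldsymbol{u}_{0}\nabla\mu_{1} + \boldsymbol{f}_{1},\qquad \nabla\cdot\boldsymbol{u}_1=0,$$ with $\boldsymbol{u}_1=\boldsymbol{0}$ on $\partial\Omega$. Notation: $(\cdot,\cdot)$ and $\|\cdot\|$ are the $L^2(\Omega)$ inner product and norm (for scalar, vector or tensor fields, with the Euclidean/Frobenius norm pointwise); $\langle\cdot,\cdot\rangle$ is the duality pairing between $H^{-1}(\Omega)$ and $H^1_0(\Omega)$;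 $\|\cdot\|_{-1}$ is the $H^{-1}(\Omega)$ norm, dual to the norm $\|\nabla\cdot\|$ on $H^1_0(\Omega)$, so $\langle \boldsymbol{f},\boldsymbol{v}\rangle\le\|\boldsymbol{f}\|_{-1}\|\nabla\boldsymbol{v}\|$; $\|\cdot\|_\infty$ is the $L^\infty(\bar Q)$ norm. $(\nabla\boldsymbol{u})_{ij}=\partial_j u^i$, and $(\nabla^{\top}\boldsymbol{u}\,\nabla\mu)_i=\sum_j \partial_i u^j\,\partial_j\mu$. Standing assumptions: - $\boldsymbol{f}_n\in[H^{-1}(\Omega)]^d$ for all $n$; the initial velocity satisfies $\boldsymbol{u}_0\in[H^1_0(\Omega)]^d$; the initial density satisfies $0<\rho_{\min}\le\rho_0\le\rho_{\max}$ in $\Omega$, with constants $\rho_{\min},\rho_{\max}$. - Viscosity: $\mu\ge\mu_{\min}>0$ in $\bar Q$ with $\mu_{\min}$ constant, and $\nabla\mu\in[L^\infty(\bar Q)]^d$; the viscosities $\mu_n$ at the time steps, which are known when $\boldsymbol{u}_n$ is computed, obey the same bounds: $\mu_n\ge\mu_{\min}$ and $|\nabla\mu_n|\le\|\nabla\mu\|_\infty$ a.e. in $\Omega$. - The numerical density satisfies $\rho_n\ge\varrho_{\min}$ a.e. in $\Omega$ for all $n=0,\dots,N$, with a constant $\varrho_{\min}\in(0,\rho_{\min}]$. - Homogeneous Dirichlet conditions $\boldsymbol{u}_n=\boldsymbol{0}$ on $\partial\Omega$ for all $n$ (so no boundary condition is needed for $\rho$). - All fields are sufficiently smooth for the equations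 to be tested with $\boldsymbol{u}_{n+1}$, $p_{n+1}$, and for the identity $\int_\Omega\big[(r\nabla\boldsymbol{v})\boldsymbol{w}+\tfrac12(\nabla\cdot(r\boldsymbol{w}))\boldsymbol{v}\big]\cdot\boldsymbol{v}\,\mathrm{d}\Omega=0$ to hold with $r=\rho_{n+1}$, $\boldsymbol{v}=\boldsymbol{u}_{n+1}$ and $\boldsymbol{w}=\boldsymbol{u}_n^\star$ (for $n\ge1$) or $\boldsymbol{w}=\boldsymbol{u}_0$ (for $n=0$). Constants: the problem data include $T$, $\mu_{\min}$, $\varrho_{\min}$, $\|\nabla\mu\|_\infty$ and the forcing (including $\|\boldsymbol{f}_1\|_{-1}$, which enters through the initialisation step). The property $\partial_\tau \tilde C\ge0$ is understood with the other arguments of $\tilde C$ held fixed. *)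

theory Defs
  imports "HOL-Analysis.Analysis" "HOL-Probability.Essential_Supremum"
begin

section \<open>Test functions\<close>

text \<open>On a Euclidean space, \<open>C_k k\<close> is the usual class \<open>C\<^sup>k\<close> on the whole space.\<close>

primrec C_k :: "nat \<Rightarrow> ('a::euclidean_space \<Rightarrow> 'b::real_normed_vector) \<Rightarrow> bool" where
  "C_k 0 \<phi> \<longleftrightarrow> continuous_on UNIV \<phi>"
| "C_k (Suc k) \<phi> \<longleftrightarrow> (\<forall>x. \<phi> differentiable (at x)) \<and>
     (\<forall>e. C_k k (\<lambda>x. frechet_derivative \<phi> (at x) e))"

definition test_fun :: "'a::euclidean_space set \<Rightarrow> ('a \<Rightarrow> 'b::real_normed_vector) \<Rightarrow> bool" where
  "test_fun \<Omega> \<phi> \<longleftrightarrow> (\<forall>k. C_k k \<phi>) \<and>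
     compact (closure {x. \<phi> x \<noteq> 0}) \<and> closure {x. \<phi> x \<noteq> 0} \<subseteq> \<Omega>"

section \<open>Weak derivatives\<close>

definition locally_integrable :: "'a::euclidean_space set \<Rightarrow> ('a \<Rightarrow> 'b::euclidean_space) \<Rightarrow> bool" where
  "locally_integrable \<Omega> f \<longleftrightarrow> (\<forall>K. compact K \<and> K \<subseteq> \<Omega> \<longrightarrow> f absolutely_integrable_on K)"

definition has_weak_deriv ::
    "'a::euclidean_space set \<Rightarrow> 'a \<Rightarrow> ('a \<Rightarrow> real) \<Rightarrow> ('a \<Rightarrow> real) \<Rightarrow> bool" where
  "has_weak_deriv \<Omega> e f g \<longleftrightarrow> locally_integrable \<Omega> f \<and> locally_integrable \<Omega> g \<and>
     (\<forall>\<phi>. test_fun \<Omega> \<phi> \<longrightarrow>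
        (LINT x|lebesgue_on \<Omega>. f x * frechet_derivative \<phi> (at x) e)
          = - (LINT x|lebesgue_on \<Omega>. g x * \<phi> x))"

definition has_weak_grad :: "(real^'d) set \<Rightarrow> (real^'d \<Rightarrow> real) \<Rightarrow> (real^'d \<Rightarrow> real^'d) \<Rightarrow> bool" where
  "has_weak_grad \<Omega> f G \<longleftrightarrow> (\<forall>j. has_weak_deriv \<Omega> (axis j 1) f (\<lambda>x. G x $ j))"

text \<open>Row \<open>i\<close>, column \<open>j\<close> of the Jacobian is \<open>\<partial>\<^sub>j u\<^sup>i\<close>.\<close>

definition has_weak_jac ::
    "(real^'d) set \<Rightarrow> (real^'d \<Rightarrow> real^'d) \<Rightarrow> (real^'d \<Rightarrow> real^'d^'d) \<Rightarrow> bool" where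
  "has_weak_jac \<Omega> u G \<longleftrightarrow>
     (\<forall>i j. has_weak_deriv \<Omega> (axis j 1) (\<lambda>x. u x $ i) (\<lambda>x. G x $ i $ j))"

text \<open>In the next definition \<open>frechet_derivative \<phi> (at x) (w x)\<close> is \<open>\<nabla>\<phi>(x) \<bullet> w(x)\<close>.
  The weak divergence may exist when the full weak Jacobian does not.\<close>

definition has_weak_div ::
    "(real^'d) set \<Rightarrow> (real^'d \<Rightarrow> real^'d) \<Rightarrow> (real^'d \<Rightarrow> real) \<Rightarrow> bool" where
  "has_weak_div \<Omega> w g \<longleftrightarrow> locally_integrable \<Omega> w \<and> locally_integrable \<Omega> g \<and>
     (\<forall>\<phi>. test_fun \<Omega> \<phi> \<longrightarrow>
        (LINT x|lebesgue_on \<Omega>. frechet_derivative \<phi> (at x) (w x))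
          = - (LINT x|lebesgue_on \<Omega>. g x * \<phi> x))"

text \<open>Weak derivatives are unique almost everywhere only; the operators below select a version.
  They are meaningful only where the corresponding weak derivative exists.\<close>

definition wgrad :: "(real^'d) set \<Rightarrow> (real^'d \<Rightarrow> real) \<Rightarrow> real^'d \<Rightarrow> real^'d" where
  "wgrad \<Omega> f = (SOME G. has_weak_grad \<Omega> f G)"

definition wjac :: "(real^'d) set \<Rightarrow> (real^'d \<Rightarrow> real^'d) \<Rightarrow> real^'d \<Rightarrow> real^'d^'d" where
  "wjac \<Omega> u = (SOME G. has_weak_jac \<Omega> u G)"

definition wdiv :: "(real^'d) set \<Rightarrow> (real^'d \<Rightarrow> real^'d) \<Rightarrow> real^'d \<Rightarrow> real" where
  "wdiv \<Omega> w = (SOME g. has_weak_div \<Omega> w g)"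

text \<open>Spatial gradient of a field on \<open>\<Omega> \<times> (0,T)\<close>, in the sense of distributions on that set.\<close>

definition has_weak_space_grad ::
    "(real^'d) set \<Rightarrow> real \<Rightarrow> ((real^'d) \<times> real \<Rightarrow> real) \<Rightarrow> ((real^'d) \<times> real \<Rightarrow> real^'d) \<Rightarrow> bool" where
  "has_weak_space_grad \<Omega> T m G \<longleftrightarrow>
     (\<forall>j. has_weak_deriv (\<Omega> \<times> {0<..<T}) (axis j 1, 0) m (\<lambda>z. G z $ j))"

definition wspace_grad ::
    "(real^'d) set \<Rightarrow> real \<Rightarrow> ((real^'d) \<times> real \<Rightarrow> real) \<Rightarrow> (real^'d) \<times> real \<Rightarrow> real^'d" where
  "wspace_grad \<Omega> T m = (SOME G. has_weak_space_grad \<Omega> T m G)"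

text \<open>The \<open>L\<^sup>\<infinity>\<close> norm over \<open>\<Omega> \<times> (0,T]\<close> is \<open>\<infinity>\<close> for unbounded (or non-measurable) fields.\<close>

definition Linf_norm ::
    "(real^'d) set \<Rightarrow> real \<Rightarrow> ((real^'d) \<times> real \<Rightarrow> real^'d) \<Rightarrow> ereal" where
  "Linf_norm \<Omega> T G = esssup (lebesgue_on (\<Omega> \<times> {0<..T})) (\<lambda>z. ereal (norm (G z)))"

section \<open>Function spaces\<close>

text \<open>The norm of \<open>real^'d^'d\<close> is the Frobenius norm and its inner product is the Frobenius product.\<close>

definition L2 :: "(real^'d) set \<Rightarrow> (real^'d \<Rightarrow> 'b::euclidean_space) \<Rightarrow> bool" where
  "L2 \<Omega> f \<longleftrightarrow> f \<in> borel_measurable (lebesgue_on \<Omega>) \<and>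
     integrable (lebesgue_on \<Omega>) (\<lambda>x. (norm (f x))\<^sup>2)"

definition L2_norm :: "(real^'d) set \<Rightarrow> (real^'d \<Rightarrow> 'b::euclidean_space) \<Rightarrow> real" where
  "L2_norm \<Omega> f = sqrt (LINT x|lebesgue_on \<Omega>. (norm (f x))\<^sup>2)"

text \<open>\<open>[H\<^sup>1\<^sub>0(\<Omega>)]\<^sup>d\<close> is the closure of the test fields in the \<open>H\<^sup>1\<close> norm.\<close>

definition H10 :: "(real^'d) set \<Rightarrow> (real^'d \<Rightarrow> real^'d) set" where
  "H10 \<Omega> = {v. L2 \<Omega> v \<and> (\<exists>G. has_weak_jac \<Omega> v G) \<and> L2 \<Omega> (wjac \<Omega> v) \<and>
     (\<exists>\<phi>. (\<forall>k. test_fun \<Omega> (\<phi> k)) \<and>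
        (\<lambda>k. L2_norm \<Omega> (\<lambda>x. \<phi> k x - v x)) \<longlonglongrightarrow> 0 \<and>
        (\<lambda>k. L2_norm \<Omega> (\<lambda>x. wjac \<Omega> (\<phi> k) x - wjac \<Omega> v x)) \<longlonglongrightarrow> 0)}"

text \<open>\<open>[H\<^sup>-\<^sup>1(\<Omega>)]\<^sup>d\<close> as the space of linear functionals on \<open>[H\<^sup>1\<^sub>0(\<Omega>)]\<^sup>d\<close> bounded with respect
  to \<open>v \<mapsto> \<parallel>\<nabla>v\<parallel>\<close>, with the dual norm; \<open>f v\<close> is the duality pairing.\<close>

definition Hm1 :: "(real^'d) set \<Rightarrow> ((real^'d \<Rightarrow> real^'d) \<Rightarrow> real) set" where
  "Hm1 \<Omega> = {f. (\<forall>v\<in>H10 \<Omega>. \<forall>w\<in>H10 \<Omega>. f (\<lambda>x. v x + w x) = f v + f w) \<and>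
     (\<forall>c. \<forall>v\<in>H10 \<Omega>. f (\<lambda>x. c *\<^sub>R v x) = c * f v) \<and>
     (\<exists>K. \<forall>v\<in>H10 \<Omega>. \<bar>f v\<bar> \<le> K * L2_norm \<Omega> (wjac \<Omega> v))}"

definition Hm1_norm :: "(real^'d) set \<Rightarrow> ((real^'d \<Rightarrow> real^'d) \<Rightarrow> real) \<Rightarrow> real" where
  "Hm1_norm \<Omega> f = (SUP v\<in>H10 \<Omega>. \<bar>f v\<bar> / L2_norm \<Omega> (wjac \<Omega> v))"

section \<open>The scheme\<close>

definition star :: "(nat \<Rightarrow> 'a \<Rightarrow> 'b::real_vector) \<Rightarrow> nat \<Rightarrow> 'a \<Rightarrow> 'b" where
  "star v n = (\<lambda>x. 2 *\<^sub>R v n x - v (n - 1) x)"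

text \<open>Below, \<open>r\<close>, \<open>v\<close>, \<open>q\<close>, \<open>m\<close> stand for the new density, velocity, pressure and viscosity, \<open>w\<close>
  for the (extrapolated) convecting velocity and \<open>\<delta>\<close> for the discrete time derivative.\<close>

definition mass_eq ::
    "(real^'d) set \<Rightarrow> (real^'d \<Rightarrow> real) \<Rightarrow> (real^'d \<Rightarrow> real) \<Rightarrow> (real^'d \<Rightarrow> real^'d) \<Rightarrow> bool" where
  "mass_eq \<Omega> \<delta> r w \<longleftrightarrow>
     (AE x in lebesgue_on \<Omega>. \<delta> x + w x \<bullet> wgrad \<Omega> r x + wdiv \<Omega> w x / 2 * r x = 0)"

definition convection ::
    "(real^'d) set \<Rightarrow> (real^'d \<Rightarrow> real) \<Rightarrow> (real^'d \<Rightarrow> real^'d) \<Rightarrow> (real^'d \<Rightarrow> real^'d)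
      \<Rightarrow> real^'d \<Rightarrow> real^'d" where
  "convection \<Omega> r v w = (\<lambda>x. (r x *\<^sub>R wjac \<Omega> v x) *v w x
      + (1/2 * wdiv \<Omega> (\<lambda>y. r y *\<^sub>R w y) x) *\<^sub>R v x)"

text \<open>The momentum balance tested with \<open>z\<close>: all terms are required to be integrable against \<open>z\<close>,
  and the viscous and pressure terms are in divergence form.\<close>

definition momentum_tested ::
    "(real^'d) set \<Rightarrow> (real^'d \<Rightarrow> real^'d) \<Rightarrow> (real^'d \<Rightarrow> real) \<Rightarrow> (real^'d \<Rightarrow> real^'d)
      \<Rightarrow> (real^'d \<Rightarrow> real^'d) \<Rightarrow> (real^'d \<Rightarrow> real) \<Rightarrow> (real^'d \<Rightarrow> real)
      \<Rightarrow> ((real^'d \<Rightarrow> real^'d) \<Rightarrow> real) \<Rightarrow> (real^'d \<Rightarrow> real^'d) \<Rightarrow> bool" where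
  "momentum_tested \<Omega> \<delta> r v w q m f z \<longleftrightarrow>
     integrable (lebesgue_on \<Omega>) (\<lambda>x. \<delta> x \<bullet> z x) \<and>
     integrable (lebesgue_on \<Omega>) (\<lambda>x. convection \<Omega> r v w x \<bullet> z x) \<and>
     integrable (lebesgue_on \<Omega>) (\<lambda>x. m x * (wjac \<Omega> v x \<bullet> wjac \<Omega> z x)) \<and>
     integrable (lebesgue_on \<Omega>) (\<lambda>x. q x * wdiv \<Omega> z x) \<and>
     integrable (lebesgue_on \<Omega>) (\<lambda>x. (transpose (wjac \<Omega> w x) *v wgrad \<Omega> m x) \<bullet> z x) \<and>
     (LINT x|lebesgue_on \<Omega>. \<delta> x \<bullet> z x)
       + (LINT x|lebesgue_on \<Omega>. convection \<Omega> r v w x \<bullet> z x)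
       + (LINT x|lebesgue_on \<Omega>. m x * (wjac \<Omega> v x \<bullet> wjac \<Omega> z x))
       - (LINT x|lebesgue_on \<Omega>. q x * wdiv \<Omega> z x)
     = (LINT x|lebesgue_on \<Omega>. (transpose (wjac \<Omega> w x) *v wgrad \<Omega> m x) \<bullet> z x) + f z"

text \<open>One time step. The momentum equation holds in the sense of distributions; the smoothness
  assumptions are that \<open>r\<close>, \<open>m\<close> are weakly differentiable, that \<open>\<nabla>\<bullet>(r w)\<close> is a function, that the
  momentum equation may be tested with the new velocity \<open>v\<close> (which includes the integrability of
  \<open>q (\<nabla>\<bullet>v)\<close>, that is, testing the divergence constraint with \<open>q\<close>), and that the convective
  term is skew-symmetric. The boundary condition on \<open>v\<close> is membership in \<open>H10\<close>.\<close>

definition imex_step ::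
    "(real^'d) set \<Rightarrow> (real^'d \<Rightarrow> real) \<Rightarrow> (real^'d \<Rightarrow> real^'d) \<Rightarrow> (real^'d \<Rightarrow> real)
      \<Rightarrow> (real^'d \<Rightarrow> real^'d) \<Rightarrow> (real^'d \<Rightarrow> real^'d) \<Rightarrow> (real^'d \<Rightarrow> real) \<Rightarrow> (real^'d \<Rightarrow> real)
      \<Rightarrow> ((real^'d \<Rightarrow> real^'d) \<Rightarrow> real) \<Rightarrow> bool" where
  "imex_step \<Omega> \<delta>\<rho> \<delta>u r v w q m f \<longleftrightarrow>
     mass_eq \<Omega> \<delta>\<rho> r w \<and>
     (\<forall>z. test_fun \<Omega> z \<longrightarrow> momentum_tested \<Omega> \<delta>u r v w q m f z) \<and>
     (AE x in lebesgue_on \<Omega>. wdiv \<Omega> v x = 0) \<and>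
     v \<in> H10 \<Omega> \<and>
     (\<exists>G. has_weak_grad \<Omega> r G) \<and> (\<exists>G. has_weak_grad \<Omega> m G) \<and>
     (\<exists>g. has_weak_div \<Omega> (\<lambda>x. r x *\<^sub>R w x) g) \<and>
     momentum_tested \<Omega> \<delta>u r v w q m f v \<and>
     (LINT x|lebesgue_on \<Omega>. convection \<Omega> r v w x \<bullet> v x) = 0"

definition first_order_step ::
    "(real^'d) set \<Rightarrow> real \<Rightarrow> (nat \<Rightarrow> real^'d \<Rightarrow> real) \<Rightarrow> (nat \<Rightarrow> real^'d \<Rightarrow> real^'d)
      \<Rightarrow> (nat \<Rightarrow> real^'d \<Rightarrow> real) \<Rightarrow> (nat \<Rightarrow> real^'d \<Rightarrow> real)
      \<Rightarrow> (nat \<Rightarrow> (real^'d \<Rightarrow> real^'d) \<Rightarrow> real) \<Rightarrow> bool" where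
  "first_order_step \<Omega> \<tau> \<rho> u p \<mu> f \<longleftrightarrow>
     imex_step \<Omega>
       (\<lambda>x. (\<rho> 1 x - \<rho> 0 x) / \<tau>)
       (\<lambda>x. (sqrt (\<rho> 1 x) / \<tau>) *\<^sub>R (sqrt (\<rho> 1 x) *\<^sub>R u 1 x - sqrt (\<rho> 0 x) *\<^sub>R u 0 x))
       (\<rho> 1) (u 1) (u 0) (p 1) (\<mu> 1) (f 1)"

definition second_order_step ::
    "(real^'d) set \<Rightarrow> real \<Rightarrow> (nat \<Rightarrow> real^'d \<Rightarrow> real) \<Rightarrow> (nat \<Rightarrow> real^'d \<Rightarrow> real^'d)
      \<Rightarrow> (nat \<Rightarrow> real^'d \<Rightarrow> real) \<Rightarrow> (nat \<Rightarrow> real^'d \<Rightarrow> real)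
      \<Rightarrow> (nat \<Rightarrow> (real^'d \<Rightarrow> real^'d) \<Rightarrow> real) \<Rightarrow> nat \<Rightarrow> bool" where
  "second_order_step \<Omega> \<tau> \<rho> u p \<mu> f n \<longleftrightarrow>
     imex_step \<Omega>
       (\<lambda>x. (3 * \<rho> (n + 1) x - 4 * \<rho> n x + \<rho> (n - 1) x) / (2 * \<tau>))
       (\<lambda>x. (sqrt (\<rho> (n + 1) x) / (2 * \<tau>)) *\<^sub>R
          (3 *\<^sub>R (sqrt (\<rho> (n + 1) x) *\<^sub>R u (n + 1) x) - 4 *\<^sub>R (sqrt (\<rho> n x) *\<^sub>R u n x)
            + sqrt (\<rho> (n - 1) x) *\<^sub>R u (n - 1) x))
       (\<rho> (n + 1)) (u (n + 1)) (star u n) (p (n + 1)) (\<mu> (n + 1)) (f (n + 1))"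

end

theory Submission
  imports Defs
begin

text \<open>Testing the momentum equation with \<open>u\<^sub>n\<^sub>+\<^sub>1\<close> removes the pressure and the convection. With
  \<open>a\<^sub>n = \<surd>\<rho>\<^sub>n u\<^sub>n\<close> the BDF2 identity gives a telescoping energy \<open>|a\<^sub>n|\<^sup>2 + |2a\<^sub>n - a\<^sub>n\<^sub>-\<^sub>1|\<^sup>2\<close> and a numerical
  dissipation, and the explicit viscous term is bounded pointwise by \<open>\<parallel>\<nabla>\<mu>\<parallel>\<^sub>\<infinity> |\<nabla>u\<^sup>\<star>| |u\<^sub>n\<^sub>+\<^sub>1|\<close>. The
  parallelogram identity \<open>\<parallel>\<nabla>u\<^sup>\<star>\<parallel>\<^sup>2 + \<parallel>2\<nabla>u\<^sub>n + \<nabla>u\<^sub>n\<^sub>-\<^sub>1\<parallel>\<^sup>2 = 8\<parallel>\<nabla>u\<^sub>n\<parallel>\<^sup>2 + 2\<parallel>\<nabla>u\<^sub>n\<^sub>-\<^sub>1\<parallel>\<^sup>2\<close> moves \<open>\<nabla>u\<^sup>\<star>\<close>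
  into the physical dissipation of the previous two steps. It requires \<open>\<nabla>u\<^sup>\<star> = 2\<nabla>u\<^sub>n - \<nabla>u\<^sub>n\<^sub>-\<^sub>1\<close> almost
  everywhere, that is, uniqueness of weak derivatives.\<close>

section \<open>Smooth bump functions\<close>

lemma C_k_Suc_imp: "C_k (Suc k) \<phi> \<Longrightarrow> C_k k \<phi>"
proof (induction k arbitrary: \<phi>)
  case 0
  then show ?case
    by (auto intro!: continuous_at_imp_continuous_on differentiable_imp_continuous_within)
next
  case (Suc k)
  then show ?case
    by (metis C_k.simps(2))
qed

lemma C_k_const: "C_k k (\<lambda>x. c)"
  by (induction k arbitrary: c) (auto simp: frechet_derivative_const)

lemma C_k_add:
  "C_k k f \<Longrightarrow> C_k k g \<Longrightarrow> C_k k (\<lambda>x. f x + g x)"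
proof (induction k arbitrary: f g)
  case 0
  then show ?case by (auto intro: continuous_intros)
next
  case (Suc k)
  have f: "f differentiable (at x)" and g: "g differentiable (at x)" for x
    using Suc.prems by auto
  have "frechet_derivative (\<lambda>x. f x + g x) (at x) e
      = frechet_derivative f (at x) e + frechet_derivative g (at x) e" for x e
    using frechet_derivative_at[OF has_derivative_add[OF
        frechet_derivative_works[THEN iffD1, OF f] frechet_derivative_works[THEN iffD1, OF g]], of x]
    by metis
  moreover have "C_k k (\<lambda>x. frechet_derivative f (at x) e)"
      "C_k k (\<lambda>x. frechet_derivative g (at x) e)" for e
    using Suc.prems by auto
  ultimately have "C_k k (\<lambda>x. frechet_derivative (\<lambda>x. f x + g x) (at x) e)" for e
    by (simp only:) (intro Suc.IH)
  then show ?case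
    using f g by simp
qed

lemma C_k_mult:
  fixes f g :: "'a::euclidean_space \<Rightarrow> real"
  shows "C_k k f \<Longrightarrow> C_k k g \<Longrightarrow> C_k k (\<lambda>x. f x * g x)"
proof (induction k arbitrary: f g)
  case 0
  then show ?case by (auto intro: continuous_intros)
next
  case (Suc k)
  have f: "f differentiable (at x)" and g: "g differentiable (at x)" for x
    using Suc.prems by auto
  have "frechet_derivative (\<lambda>x. f x * g x) (at x) e
      = f x * frechet_derivative g (at x) e + frechet_derivative f (at x) e * g x" for x e
    using frechet_derivative_at[OF has_derivative_mult[OF
        frechet_derivative_works[THEN iffD1, OF f] frechet_derivative_works[THEN iffD1, OF g]], of x] by metis
  \<comment> \<open>The product rule leaves one factor undifferentiated; it is needed only at order
    \<open>k\<close>, so it is lowered from \<open>Suc k\<close>.\<close>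
  moreover have "C_k k f" "C_k k g"
    using Suc.prems C_k_Suc_imp by blast+
  moreover have "C_k k (\<lambda>x. frechet_derivative f (at x) e)"
      "C_k k (\<lambda>x. frechet_derivative g (at x) e)" for e
    using Suc.prems by auto
  ultimately have "C_k k (\<lambda>x. frechet_derivative (\<lambda>x. f x * g x) (at x) e)" for e
    by (simp only:) (intro C_k_add Suc.IH)
  then show ?case
    using f g by simp
qed

lemma C_k_prod:
  fixes f :: "'i \<Rightarrow> 'a::euclidean_space \<Rightarrow> real"
  assumes "\<And>i. i \<in> I \<Longrightarrow> C_k k (f i)"
  shows "C_k k (\<lambda>x. \<Prod>i\<in>I. f i x)"
  using assms by (induction I rule: infinite_finite_induct) (auto intro: C_k_mult C_k_const)

text \<open>For \<open>p = 1\<close> this is the classical smooth function exp(-1/t), extended by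
  zero to t \<le> 0. The polynomial in \<open>1 / t\<close> is carried along because differentiation
  produces such factors, so that the family is closed under derivatives.\<close>

definition flat :: "real poly \<Rightarrow> real \<Rightarrow> real" where
  "flat p t = (if t > 0 then poly p (1 / t) * exp (- (1 / t)) else 0)"

lemma poly_exp_tendsto_0: "((\<lambda>t. poly p t * exp (- t)) \<longlongrightarrow> (0::real)) at_top"
proof -
  have "((\<lambda>t. coeff p i * t ^ i * exp (- t)) \<longlongrightarrow> 0) at_top" for i
  proof -
    have "((\<lambda>t::real. t ^ i * exp (- t)) \<longlongrightarrow> 0) at_top"
      using tendsto_power_div_exp_0[of i] by (simp add: exp_minus field_simps)
    from tendsto_mult_left[OF this, of "coeff p i"] show ?thesis
      by (simp add: mult.assoc)
  qed
  then have "((\<lambda>t. \<Sum>i\<le>degree p. coeff p i * t ^ i * exp (- t)) \<longlongrightarrow> 0) at_top"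
    by (intro tendsto_null_sum) auto
  then show ?thesis
    by (simp add: poly_altdef sum_distrib_right)
qed

text \<open>For t > 0 the chain rule yields (1/t^2) (p - p')(1/t) exp(-1/t), and
  \<open>[:0, 0, 1:]\<close> is the square of the variable, evaluated at \<open>1 / t\<close>. Only
  t = 0 needs an argument about limits.\<close>

lemma has_field_derivative_flat:
  "(flat p has_field_derivative flat ([:0, 0, 1:] * (p - pderiv p)) t) (at t)"
proof (cases t "0::real" rule: linorder_cases)
  case less
  then have "eventually (\<lambda>s. flat p s = 0) (nhds t)"
    using eventually_nhds_in_open[of "{..<0}" t] by (auto elim!: eventually_mono simp: flat_def)
  with less show ?thesis
    by (subst DERIV_cong_ev[OF refl _ refl, of _ "\<lambda>_. 0"]) (auto simp: flat_def)
next
  case equal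
  have "((\<lambda>s. flat p s / s) \<longlongrightarrow> 0) (at_right 0)"
  proof -
    \<comment> \<open>\<open>pCons 0 p\<close> is \<open>p\<close> times the variable. Evaluated at
      \<open>inverse s\<close> the extra factor is the division by \<open>s\<close> in the
      difference quotient, and the exponential still dominates.\<close>
    have "((\<lambda>s. poly (pCons 0 p) (inverse s) * exp (- inverse s)) \<longlongrightarrow> 0) (at_right 0)"
      using filterlim_compose[OF poly_exp_tendsto_0[of "pCons 0 p"] filterlim_inverse_at_top_right] .
    moreover have "eventually (\<lambda>s. poly (pCons 0 p) (inverse s) * exp (- inverse s) = flat p s / s)
        (at_right 0)"
      using eventually_at_right_less[of 0] by eventually_elim (auto simp: flat_def field_simps)
    ultimately show ?thesis
      using tendsto_cong by force
  qed
  moreover have "((\<lambda>s. flat p s / s) \<longlongrightarrow> 0) (at_left 0)"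
    by (rule tendsto_eventually) (auto simp: flat_def eventually_at_filter)
  ultimately have "((\<lambda>s. flat p s / s) \<longlongrightarrow> 0) (at 0)"
    by (simp add: filterlim_at_split)
  with equal show ?thesis
    by (auto simp: has_field_derivative_iff flat_def)
next
  case greater
  have "((\<lambda>s. poly p (1 / s) * exp (- (1 / s))) has_field_derivative
      poly ([:0, 0, 1:] * (p - pderiv p)) (1 / t) * exp (- (1 / t))) (at t)"
    using greater
    by (auto intro!: derivative_eq_intros simp: power2_eq_square field_simps)
  moreover have "eventually (\<lambda>s. flat p s = poly p (1 / s) * exp (- (1 / s))) (nhds t)"
    using eventually_nhds_in_open[of "{0<..}" t] greater
    by (auto elim!: eventually_mono simp: flat_def)
  ultimately show ?thesis
    using greater by (subst DERIV_cong_ev[OF refl _ refl]) (auto simp: flat_def)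
qed

text \<open>Induction on \<open>k\<close> with \<open>p\<close> arbitrary: a directional derivative
  is \<open>flat\<close> of another polynomial at the same affine argument, times the constant
  \<open>b \<bullet> e\<close>.\<close>

lemma C_k_flat_affine:
  fixes b :: "'a::euclidean_space"
  shows "C_k k (\<lambda>x. flat p (b \<bullet> x + d))"
proof (induction k arbitrary: p)
  case 0
  have "isCont (flat p) t" for t
    using has_field_derivative_flat DERIV_isCont by blast
  then have "isCont (\<lambda>x. flat p (b \<bullet> x + d)) x" for x
    by (rule isCont_o2[rotated]) (intro continuous_intros)
  then show ?case by (simp add: continuous_at_imp_continuous_on)
next
  case (Suc k)
  let ?q = "[:0, 0, 1:] * (p - pderiv p)"
  have d: "((\<lambda>x. flat p (b \<bullet> x + d)) has_derivative (\<lambda>h. flat ?q (b \<bullet> x + d) * (b \<bullet> h))) (at x)" for x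
    by (rule has_derivative_compose[OF _ has_field_derivative_flat[unfolded has_field_derivative_def]])
       (auto intro!: derivative_eq_intros)
  have "C_k k (\<lambda>x. flat ?q (b \<bullet> x + d) * (b \<bullet> e))" for e
    by (intro C_k_mult Suc C_k_const)
  moreover have "frechet_derivative (\<lambda>x. flat p (b \<bullet> x + d)) (at x) e = flat ?q (b \<bullet> x + d) * (b \<bullet> e)" for x e
    using frechet_derivative_at[OF d, of x] by metis
  ultimately show ?case
    using differentiableI[OF d] by simp
qed

text \<open>Each factor is positive exactly on an open half-space bounded by a face of the box, so
  the product is positive exactly on the open box. The scaling by \<open>Suc k\<close> drives every
  positive factor to 1, which makes the bumps approximate the indicator of the box.\<close>

definition bump :: "'a::euclidean_space \<Rightarrow> 'a \<Rightarrow> nat \<Rightarrow> 'a \<Rightarrow> real" where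
  "bump a b k x = (\<Prod>i\<in>Basis. flat 1 (Suc k * (x \<bullet> i - a \<bullet> i)) * flat 1 (Suc k * (b \<bullet> i - x \<bullet> i)))"

lemma flat_1: "0 \<le> flat 1 t" "flat 1 t \<le> 1" "flat 1 t = 0 \<longleftrightarrow> t \<le> 0"
  by (auto simp: flat_def)

lemma bump_bounds: "0 \<le> bump a b k x" "bump a b k x \<le> 1"
  unfolding bump_def by (auto intro!: prod_nonneg prod_le_1 mult_le_one mult_nonneg_nonneg flat_1)

lemma bump_eq_0_iff: "bump a b k x = 0 \<longleftrightarrow> x \<notin> box a b"
  by (auto simp: bump_def flat_1 mem_box mult_le_0_iff not_less)

lemma test_fun_bump:
  assumes "cbox a b \<subseteq> \<Omega>"
  shows "test_fun \<Omega> (bump a b k)"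
proof -
  have "C_k n (bump a b k)" for n
  proof -
    \<comment> \<open>Both kinds of factors are brought to the affine form for which smoothness is
      known.\<close>
    have eq: "flat 1 (Suc k * (x \<bullet> i - a \<bullet> i)) = flat 1 ((real (Suc k) *\<^sub>R i) \<bullet> x + (- (real (Suc k) * (a \<bullet> i))))"
         "flat 1 (Suc k * (b \<bullet> i - x \<bullet> i)) = flat 1 (((- real (Suc k)) *\<^sub>R i) \<bullet> x + real (Suc k) * (b \<bullet> i))" for x i :: 'a
      by (auto simp: algebra_simps inner_commute intro!: arg_cong[of _ _ "flat 1"])
    show ?thesis
      unfolding bump_def[abs_def] eq by (intro C_k_prod C_k_mult C_k_flat_affine)
  qed
  moreover have "{x. bump a b k x \<noteq> 0} = box a b"
    by (auto simp: bump_eq_0_iff)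
  moreover have "closure (box a b) \<subseteq> cbox a b"
    by (intro closure_minimal closed_cbox) (simp add: box_subset_cbox)
  ultimately show ?thesis
    using assms by (auto simp: test_fun_def intro: compact_closure bounded_box)
qed

lemma bump_tendsto: "(\<lambda>k. bump a b k x) \<longlonglongrightarrow> indicat_real (box a b) x"
proof (cases "x \<in> box a b")
  case True
  have "(\<lambda>k. flat 1 (Suc k * c)) \<longlonglongrightarrow> 1" if "c > 0" for c :: real
  proof -
    have "filterlim (\<lambda>k. Suc k * c) at_top sequentially"
      using that
      by (intro filterlim_at_top_mult_tendsto_pos[OF tendsto_const _
            filterlim_compose[OF filterlim_real_sequentially filterlim_Suc]])
    from tendsto_exp[OF tendsto_minus[OF tendsto_divide_0[OF tendsto_const
          filterlim_at_top_imp_at_infinity[OF this]]]]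
    have "(\<lambda>k. exp (- (1 / (Suc k * c)))) \<longlonglongrightarrow> 1"
      by simp
    then show ?thesis
      using that by (simp add: flat_def zero_less_mult_iff del: of_nat_Suc)
  qed
  with True have "(\<lambda>k. bump a b k x) \<longlonglongrightarrow> (\<Prod>i\<in>(Basis::'a set). 1 * 1)"
    unfolding bump_def by (intro tendsto_prod tendsto_mult) (auto simp: mem_box)
  with True show ?thesis by simp
next
  case False
  then have "bump a b k x = 0" for k
    by (simp add: bump_eq_0_iff)
  with False show ?thesis by simp
qed

section \<open>The fundamental lemma of the calculus of variations\<close>

text \<open>A Dynkin argument: open boxes are stable under intersection and generate the Borel sets.
  The vanishing total integral handles complements, countable additivity handles disjoint
  unions.\<close>

lemma set_integral_lebesgue_zero_from_boxes:
  fixes g :: "'a::euclidean_space \<Rightarrow> real"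
  assumes g: "integrable lebesgue g"
    and box: "\<And>a b. (LINT x:box a b|lebesgue. g x) = 0"
    and tot: "(LINT x|lebesgue. g x) = 0"
    and A: "A \<in> sets lebesgue"
  shows "(LINT x:A|lebesgue. g x) = 0"
proof -
  have si: "set_integrable lebesgue B g" if "B \<in> sets lebesgue" for B
    using g that unfolding set_integrable_def by (intro integrable_mult_indicator)
  have bor: "(LINT x:B|lebesgue. g x) = 0" if "B \<in> sets borel" for B
  proof -
    have sets: "sigma_sets UNIV (range (\<lambda>(a, b). box a b :: 'a set)) = sets borel"
      by (simp add: borel_eq_box sets_measure_of)
    have stable: "Int_stable (range (\<lambda>(a, b). box a b :: 'a set))"
      by (auto simp: Int_stable_def box_Int_box)
    have B: "B \<in> sigma_sets UNIV (range (\<lambda>(a, b). box a b :: 'a set))"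
      unfolding sets by (rule that)
    have pow: "range (\<lambda>(a, b). box a b :: 'a set) \<subseteq> Pow UNIV"
      by simp
    from stable pow B show ?thesis
    proof (induction rule: sigma_sets_induct_disjoint)
      case (compl B)
      then have [measurable]: "B \<in> sets lebesgue"
        by (simp add: sets)
      have "(LINT x:UNIV|lebesgue. g x) = (LINT x:B|lebesgue. g x) + (LINT x:UNIV-B|lebesgue. g x)"
        by (subst set_integral_Un[symmetric]) (auto intro!: si)
      with compl tot show ?case by (simp add: set_lebesgue_integral_def)
    next
      case (union B)
      then have "B i \<in> sets lebesgue" for i
        using sets by (auto simp: subset_eq)
      moreover have "i \<noteq> j \<Longrightarrow> B i \<inter> B j = {}" for i j
        using union by (auto simp: disjoint_family_on_def)
      ultimately show ?case
        using union by (subst lebesgue_integral_countable_add) (auto intro!: si)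
    qed (use box in \<open>auto simp: set_lebesgue_integral_def\<close>)
  qed
  \<comment> \<open>A Lebesgue set is a Borel set up to a subset of a null set, which does not
    affect the integral.\<close>
  obtain S N N' where S: "A = S \<union> N" "N \<subseteq> N'" "N' \<in> null_sets lborel" "S \<in> sets lborel"
    using A by (rule sets_completionE)
  have "AE x in lebesgue. x \<notin> N'"
    using S(3) by (intro AE_completion AE_not_in)
  then have "AE x in lebesgue. indicat_real A x *\<^sub>R g x = indicat_real S x *\<^sub>R g x"
    using S by (auto elim!: eventually_mono simp: indicator_def)
  then have "(LINT x:A|lebesgue. g x) = (LINT x:S|lebesgue. g x)"
    unfolding set_lebesgue_integral_def using A S(4)
    by (intro integral_cong_AE borel_measurable_integrable[OF si[unfolded set_integrable_def]]) auto
  with bor S show ?thesis by simp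
qed

text \<open>Bumps are test functions converging boundedly to indicators of boxes, so by dominated
  convergence \<open>g\<close> has integral zero over boxes well inside \<Omega>. Hence all set
  integrals of \<open>g\<close> cut off to such a box vanish, \<open>g\<close> is zero almost
  everywhere there, and countably many closed boxes cover \<Omega>.\<close>

lemma fundamental_lemma_calculus_of_variations:
  fixes g :: "'a::euclidean_space \<Rightarrow> real"
  assumes \<Omega>: "open \<Omega>" and g: "locally_integrable \<Omega> g"
    and test: "\<And>\<phi>. test_fun \<Omega> \<phi> \<Longrightarrow> (LINT x|lebesgue_on \<Omega>. g x * \<phi> x) = 0"
  shows "AE x in lebesgue_on \<Omega>. g x = 0"
proof -
  have [measurable]: "\<Omega> \<in> sets lebesgue" using \<Omega> by simp
  have int_box: "(LINT x:box a b|lebesgue. g x) = 0" if ab: "cbox a b \<subseteq> \<Omega>" for a b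
  proof -
    have gi: "integrable lebesgue (\<lambda>x. indicator (cbox a b) x * g x)"
      using g ab by (auto simp: locally_integrable_def set_integrable_def)
    \<comment> \<open>The cut-off to the compact box makes a locally integrable \<open>g\<close>
      integrable on the whole space; its absolute value is also the dominating function.\<close>
    define F where "F k x = (indicator (cbox a b) x * g x) * bump a b k x" for k x
    have "(LINT x|lebesgue. F k x) = 0" for k
    proof -
      have "(LINT x|lebesgue. F k x) = (LINT x|lebesgue. indicator \<Omega> x *\<^sub>R (g x * bump a b k x))"
        using ab bump_eq_0_iff[of a b k] box_subset_cbox[of a b]
        by (intro Bochner_Integration.integral_cong) (auto simp: F_def indicator_def)
      also have "\<dots> = 0"
        using test[OF test_fun_bump[OF ab]] by (simp add: integral_restrict_space)
      finally show ?thesis .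
    qed
    moreover have "(\<lambda>k. LINT x|lebesgue. F k x) \<longlonglongrightarrow> (LINT x|lebesgue. (indicator (cbox a b) x * g x) * indicator (box a b) x)"
    proof (rule integral_dominated_convergence[where w = "\<lambda>x. norm (indicator (cbox a b) x * g x)"])
      show "F k \<in> borel_measurable lebesgue" for k
      proof -
        have "continuous_on UNIV (bump a b k)"
          using test_fun_bump[OF ab, of k] by (auto simp: test_fun_def dest!: spec[of _ 0])
        then have "bump a b k \<in> borel_measurable lebesgue"
          by (intro measurable_completion) (auto intro: borel_measurable_continuous_onI)
        from borel_measurable_times[OF borel_measurable_integrable[OF gi] this] show ?thesis
          unfolding F_def[abs_def] .
      qed
      show "(\<lambda>x. indicator (cbox a b) x * g x * indicat_real (box a b) x) \<in> borel_measurable lebesgue"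
        by (intro borel_measurable_times[OF borel_measurable_integrable[OF gi]]
            measurable_completion borel_measurable_indicator) auto
      show "AE x in lebesgue. (\<lambda>k. F k x) \<longlonglongrightarrow> indicator (cbox a b) x * g x * indicat_real (box a b) x"
        unfolding F_def by (intro AE_I2 tendsto_mult tendsto_const bump_tendsto)
      show "AE x in lebesgue. norm (F k x) \<le> norm (indicator (cbox a b) x * g x)" for k
        using bump_bounds[of a b k] by (intro AE_I2) (simp add: F_def abs_mult mult_left_le)
    qed (use gi in auto)
    moreover have "(LINT x|lebesgue. (indicator (cbox a b) x * g x) * indicator (box a b) x) = (LINT x:box a b|lebesgue. g x)"
      unfolding set_lebesgue_integral_def using box_subset_cbox[of a b]
      by (intro Bochner_Integration.integral_cong) (auto simp: indicator_def)
    ultimately show ?thesis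
      by (simp add: LIMSEQ_const_iff)
  qed
  have AE_box: "AE x in lebesgue. x \<in> cbox a b \<longrightarrow> g x = 0" if ab: "cbox a b \<subseteq> \<Omega>" for a b
  proof -
    define h where "h x = indicator (cbox a b) x * g x" for x
    have h: "integrable lebesgue h"
      using g ab by (auto simp: locally_integrable_def set_integrable_def h_def[abs_def])
    \<comment> \<open>The faces of a box form a null set, so open and closed boxes may be exchanged
      under the integral.\<close>
    have bdry: "AE x in lebesgue. x \<in> cbox a b \<longrightarrow> x \<in> box a b"
      using AE_not_in[OF negligible_frontier_interval[of a b, unfolded negligible_iff_null_sets]]
      by eventually_elim blast
    have hb: "(LINT x:box c d|lebesgue. h x) = 0" for c d
    proof -
      obtain a' b' where ab': "box a' b' = box a b \<inter> box c d"
        by (rule that[OF box_Int_box[symmetric]])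
      \<comment> \<open>An empty \<open>box a' b'\<close> is treated apart: the corresponding
        \<open>cbox a' b'\<close> can still be a nonempty degenerate box that leaves \<Omega>. In
        the other case it is the closure of the open box and stays inside
        \<open>cbox a b\<close>.\<close>
      have "cbox a' b' \<subseteq> \<Omega> \<or> box a' b' = {}"
      proof (cases "box a' b' = {}")
        case False
        then have "cbox a' b' = closure (box a' b')" by simp
        also have "\<dots> \<subseteq> cbox a b"
          using ab' box_subset_cbox[of a b] by (intro closure_minimal) auto
        finally show ?thesis using ab by auto
      qed auto
      then have "(LINT x:box a' b'|lebesgue. g x) = 0"
        using int_box[of a' b'] by (auto simp: set_lebesgue_integral_def)
      moreover have "(LINT x:box c d|lebesgue. h x) = (LINT x:box a' b'|lebesgue. g x)"
        unfolding set_lebesgue_integral_def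
      proof (rule integral_cong_AE)
        show "AE x in lebesgue. indicat_real (box c d) x *\<^sub>R h x = indicat_real (box a' b') x *\<^sub>R g x"
          using bdry box_subset_cbox[of a b]
          by (auto elim!: eventually_mono simp: h_def indicator_def ab')
        have "(\<lambda>x. indicat_real (box a' b') x *\<^sub>R g x) = (\<lambda>x. indicat_real (box a' b') x *\<^sub>R h x)"
          using box_subset_cbox[of a b] by (auto simp: h_def indicator_def ab' fun_eq_iff)
        moreover have "integrable lebesgue (\<lambda>x. indicat_real (box a' b') x *\<^sub>R h x)"
          using h by (intro integrable_mult_indicator) auto
        ultimately show "(\<lambda>x. indicat_real (box a' b') x *\<^sub>R g x) \<in> borel_measurable lebesgue"
          by simp
      qed (rule borel_measurable_integrable[OF integrable_mult_indicator[OF _ h]], simp)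
      ultimately show ?thesis by simp
    qed
    have ht: "(LINT x|lebesgue. h x) = 0"
    proof -
      have "(LINT x|lebesgue. h x) = (LINT x:box a b|lebesgue. h x)"
        unfolding set_lebesgue_integral_def
      proof (rule integral_cong_AE)
        show "AE x in lebesgue. h x = indicat_real (box a b) x *\<^sub>R h x"
          using bdry by (auto elim!: eventually_mono simp: h_def indicator_def)
        show "(\<lambda>x. indicat_real (box a b) x *\<^sub>R h x) \<in> borel_measurable lebesgue"
          by (rule borel_measurable_integrable[OF integrable_mult_indicator[OF _ h]]) simp
      qed (rule borel_measurable_integrable[OF h])
      then show ?thesis using hb by simp
    qed
    have "AE x in lebesgue. h x = 0"
      using set_integral_lebesgue_zero_from_boxes[OF h hb ht] h
      by (intro density_unique_real) (auto simp: set_lebesgue_integral_def)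
    then show ?thesis
      by (auto elim!: eventually_mono simp: h_def)
  qed
  obtain \<D> where \<D>: "countable \<D>" "\<D> \<subseteq> Pow \<Omega>" "\<forall>X\<in>\<D>. \<exists>a b. X = cbox a b" "\<Union>\<D> = \<Omega>"
  proof (rule open_countable_Union_open_cbox[OF \<Omega>])
    fix \<D> assume "countable \<D>" "\<D> \<subseteq> Pow \<Omega>" "\<And>X. X \<in> \<D> \<Longrightarrow> \<exists>a b. X = cbox a b" "\<Union>\<D> = \<Omega>"
    then show thesis by (intro that ballI)
  qed
  have "AE x in lebesgue. \<forall>X\<in>\<D>. x \<in> X \<longrightarrow> g x = 0"
    unfolding AE_ball_countable[OF \<D>(1)]
  proof
    fix X assume "X \<in> \<D>"
    moreover from this obtain a b where "X = cbox a b" using \<D>(3) by blast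
    ultimately show "AE x in lebesgue. x \<in> X \<longrightarrow> g x = 0"
      using \<D>(2) AE_box[of a b] by blast
  qed
  then have "AE x in lebesgue. x \<in> \<Omega> \<longrightarrow> g x = 0"
    by eventually_elim (use \<D>(4) in blast)
  then show ?thesis
    by (simp add: AE_restrict_space_iff)
qed


section \<open>Weak derivatives\<close>

lemma integrable_mult_compact_support:
  fixes f \<psi> :: "'a::euclidean_space \<Rightarrow> real"
  assumes \<Omega>: "open \<Omega>" and f: "locally_integrable \<Omega> f"
    and K: "compact K" "K \<subseteq> \<Omega>" and \<psi>: "continuous_on UNIV \<psi>" "\<And>x. x \<notin> K \<Longrightarrow> \<psi> x = 0"
  shows "integrable (lebesgue_on \<Omega>) (\<lambda>x. f x * \<psi> x)"
proof -
  have fK: "integrable lebesgue (\<lambda>x. indicator K x * f x)"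
    using f K by (auto simp: locally_integrable_def set_integrable_def)
  have "compact (\<psi> ` K)"
    using K \<psi> by (intro compact_continuous_image) (auto intro: continuous_on_subset)
  then obtain B where B: "\<forall>x\<in>K. \<bar>\<psi> x\<bar> \<le> B"
    by (auto simp: bounded_iff dest!: compact_imp_bounded)
  have \<psi>_meas: "\<psi> \<in> borel_measurable lebesgue"
    using \<psi> by (intro measurable_completion) (auto intro: borel_measurable_continuous_onI)
  have "integrable lebesgue (\<lambda>x. (indicator K x * f x) * \<psi> x)"
  proof (rule Bochner_Integration.integrable_bound)
    show "integrable lebesgue (\<lambda>x. B * (indicator K x * f x))"
      using fK by simp
    show "(\<lambda>x. (indicator K x * f x) * \<psi> x) \<in> borel_measurable lebesgue"
      by (intro borel_measurable_times borel_measurable_integrable[OF fK] \<psi>_meas)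
    show "AE x in lebesgue. norm ((indicator K x * f x) * \<psi> x) \<le> norm (B * (indicator K x * f x))"
    proof (intro AE_I2)
      fix x
      show "norm ((indicator K x * f x) * \<psi> x) \<le> norm (B * (indicator K x * f x))"
      proof (cases "x \<in> K")
        case True
        then have "\<bar>\<psi> x\<bar> \<le> \<bar>B\<bar>"
          using B by fastforce
        with True show ?thesis
          using mult_right_mono[of "\<bar>\<psi> x\<bar>" "\<bar>B\<bar>" "\<bar>f x\<bar>"] by (simp add: abs_mult mult.commute)
      qed simp
    qed
  qed
  moreover have "(\<lambda>x. (indicator K x * f x) * \<psi> x) = (\<lambda>x. indicator \<Omega> x *\<^sub>R (f x * \<psi> x))"
    using K \<psi> by (fastforce simp: indicator_def)
  ultimately show ?thesis
    using \<Omega> by (simp add: integrable_restrict_space)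
qed

lemma integrable_mult_test_fun:
  fixes f :: "'a::euclidean_space \<Rightarrow> real"
  assumes "open \<Omega>" "locally_integrable \<Omega> f" "test_fun \<Omega> \<phi>"
  shows "integrable (lebesgue_on \<Omega>) (\<lambda>x. f x * \<phi> x)"
    and "integrable (lebesgue_on \<Omega>) (\<lambda>x. f x * frechet_derivative \<phi> (at x) e)"
proof -
  let ?K = "closure {x. \<phi> x \<noteq> 0}"
  have K: "compact ?K" "?K \<subseteq> \<Omega>" and C: "C_k (Suc 0) \<phi>"
    using assms(3) by (auto simp: test_fun_def simp del: C_k.simps)
  have out: "\<phi> x = 0" if "x \<notin> ?K" for x
    using that closure_subset[of "{x. \<phi> x \<noteq> 0}"] by auto
  have "continuous_on UNIV \<phi>"
    using C_k_Suc_imp[OF C] by simp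
  then show "integrable (lebesgue_on \<Omega>) (\<lambda>x. f x * \<phi> x)"
    by (rule integrable_mult_compact_support[OF assms(1,2) K _ out])
  \<comment> \<open>The complement of the closed support is open, so \<phi> vanishes in a
    neighbourhood of \<open>x\<close>.\<close>
  have "frechet_derivative \<phi> (at x) e = 0" if x: "x \<notin> ?K" for x
  proof -
    have "((\<lambda>x. 0) has_derivative (\<lambda>h. 0)) (at x)"
      by simp
    then have "(\<phi> has_derivative (\<lambda>h. 0)) (at x)"
    proof (rule has_derivative_transform_within_open)
      show "open (- ?K)"
        by (rule open_Compl[OF closed_closure])
      show "x \<in> - ?K" using x by simp
      show "0 = \<phi> y" if "y \<in> - ?K" for y
        using out[of y] that by (simp only: Compl_iff not_False_eq_True)
    qed
    from fun_cong[OF frechet_derivative_at[OF this], of e] show ?thesis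
      by simp
  qed
  moreover have "continuous_on UNIV (\<lambda>x. frechet_derivative \<phi> (at x) e)"
    using C by simp
  ultimately show "integrable (lebesgue_on \<Omega>) (\<lambda>x. f x * frechet_derivative \<phi> (at x) e)"
    by (intro integrable_mult_compact_support[OF assms(1,2) K])
qed

lemma locally_integrable_lincomb:
  fixes f g :: "'a::euclidean_space \<Rightarrow> real"
  assumes "locally_integrable \<Omega> f" "locally_integrable \<Omega> g"
  shows "locally_integrable \<Omega> (\<lambda>x. a * f x + b * g x)"
  using assms unfolding locally_integrable_def
  by (intro allI impI set_integral_add(1) set_integrable_mult_right) auto

text \<open>The compact support of the test function makes all four products integrable over
  \<Omega>; this is what permits splitting the integrals of merely locally integrable
  functions.\<close>

lemma has_weak_deriv_lincomb:
  assumes \<Omega>: "open \<Omega>" and 1: "has_weak_deriv \<Omega> e f1 g1" and 2: "has_weak_deriv \<Omega> e f2 g2"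
  shows "has_weak_deriv \<Omega> e (\<lambda>x. a * f1 x + b * f2 x) (\<lambda>x. a * g1 x + b * g2 x)"
proof -
  have "(LINT x|lebesgue_on \<Omega>. (a * f1 x + b * f2 x) * frechet_derivative \<phi> (at x) e)
      = - (LINT x|lebesgue_on \<Omega>. (a * g1 x + b * g2 x) * \<phi> x)" if \<phi>: "test_fun \<Omega> \<phi>" for \<phi>
  proof -
    have i: "integrable (lebesgue_on \<Omega>) (\<lambda>x. f1 x * frechet_derivative \<phi> (at x) e)"
      "integrable (lebesgue_on \<Omega>) (\<lambda>x. f2 x * frechet_derivative \<phi> (at x) e)"
      "integrable (lebesgue_on \<Omega>) (\<lambda>x. g1 x * \<phi> x)"
      "integrable (lebesgue_on \<Omega>) (\<lambda>x. g2 x * \<phi> x)"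
      using 1 2 by (auto simp: has_weak_deriv_def intro!: integrable_mult_test_fun[OF \<Omega> _ \<phi>])
    have "(LINT x|lebesgue_on \<Omega>. (a * f1 x + b * f2 x) * frechet_derivative \<phi> (at x) e)
        = a * (LINT x|lebesgue_on \<Omega>. f1 x * frechet_derivative \<phi> (at x) e)
          + b * (LINT x|lebesgue_on \<Omega>. f2 x * frechet_derivative \<phi> (at x) e)"
      using i(1,2) by (simp add: distrib_right mult.assoc)
    also have "\<dots> = a * - (LINT x|lebesgue_on \<Omega>. g1 x * \<phi> x) + b * - (LINT x|lebesgue_on \<Omega>. g2 x * \<phi> x)"
      using 1 2 \<phi> by (simp add: has_weak_deriv_def)
    also have "\<dots> = - (LINT x|lebesgue_on \<Omega>. (a * g1 x + b * g2 x) * \<phi> x)"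
      using i(3,4) by (simp add: distrib_right mult.assoc)
    finally show ?thesis .
  qed
  then show ?thesis
    using 1 2 unfolding has_weak_deriv_def by (intro conjI locally_integrable_lincomb) auto
qed

text \<open>The difference of \<open>g\<close> and \<open>h\<close> is a weak derivative of f - f =
  0 and therefore integrates to zero against every test function.\<close>

lemma has_weak_deriv_unique:
  assumes \<Omega>: "open \<Omega>" and 1: "has_weak_deriv \<Omega> e f g" and 2: "has_weak_deriv \<Omega> e f h"
  shows "AE x in lebesgue_on \<Omega>. g x = h x"
proof -
  have 0: "has_weak_deriv \<Omega> e (\<lambda>x. 1 * f x + (-1) * f x) (\<lambda>x. 1 * g x + (-1) * h x)"
    by (rule has_weak_deriv_lincomb[OF \<Omega> 1 2])
  have "AE x in lebesgue_on \<Omega>. 1 * g x + (-1) * h x = 0"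
    using 0 by (intro fundamental_lemma_calculus_of_variations[OF \<Omega>]) (auto simp: has_weak_deriv_def)
  then show ?thesis by simp
qed

lemma has_weak_jac_unique:
  assumes \<Omega>: "open \<Omega>" and "has_weak_jac \<Omega> u G" "has_weak_jac \<Omega> u H"
  shows "AE x in lebesgue_on \<Omega>. G x = H x"
proof -
  have "AE x in lebesgue_on \<Omega>. \<forall>i\<in>UNIV. \<forall>j\<in>UNIV. G x $ i $ j = H x $ i $ j"
    by (intro AE_finite_allI finite
        has_weak_deriv_unique[OF \<Omega> assms(2,3)[unfolded has_weak_jac_def, rule_format]])
  then show ?thesis
    by (simp add: vec_eq_iff)
qed

text \<open>\<open>wjac\<close> picks an arbitrary version and so need not be linear pointwise. The
  combination of the two chosen versions and the version chosen for \<open>star u n\<close> are both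
  weak Jacobians of the same field, hence agree almost everywhere.\<close>

lemma AE_wjac_star:
  assumes \<Omega>: "open \<Omega>" and G: "has_weak_jac \<Omega> (u n) G" and H: "has_weak_jac \<Omega> (u (n - 1)) H"
  shows "AE x in lebesgue_on \<Omega>. wjac \<Omega> (star u n) x = 2 *\<^sub>R wjac \<Omega> (u n) x - wjac \<Omega> (u (n - 1)) x"
proof (rule has_weak_jac_unique[OF \<Omega>])
  have "has_weak_jac \<Omega> (u n) (wjac \<Omega> (u n))" "has_weak_jac \<Omega> (u (n - 1)) (wjac \<Omega> (u (n - 1)))"
    unfolding wjac_def by (rule someI[of "has_weak_jac \<Omega> _", OF G] someI[of "has_weak_jac \<Omega> _", OF H])+
  then have "has_weak_deriv \<Omega> (axis j 1) (\<lambda>x. 2 * u n x $ i + (-1) * u (n - 1) x $ i)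
      (\<lambda>x. 2 * wjac \<Omega> (u n) x $ i $ j + (-1) * wjac \<Omega> (u (n - 1)) x $ i $ j)" for i j
    by (intro has_weak_deriv_lincomb[OF \<Omega>]) (auto simp: has_weak_jac_def)
  then show *: "has_weak_jac \<Omega> (star u n) (\<lambda>x. 2 *\<^sub>R wjac \<Omega> (u n) x - wjac \<Omega> (u (n - 1)) x)"
    by (simp add: has_weak_jac_def star_def)
  show "has_weak_jac \<Omega> (star u n) (wjac \<Omega> (star u n))"
    unfolding wjac_def[of _ "star u n"] by (rule someI[of "has_weak_jac \<Omega> _", OF *])
qed

section \<open>Square integrable fields\<close>

lemma L2_norm_nonneg: "0 \<le> L2_norm \<Omega> f"
  by (simp add: L2_norm_def)

lemma L2_norm_power2: "(L2_norm \<Omega> f)\<^sup>2 = (LINT x|lebesgue_on \<Omega>. (norm (f x))\<^sup>2)"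
  by (simp add: L2_norm_def)

lemma L2_integrable: "L2 \<Omega> f \<Longrightarrow> integrable (lebesgue_on \<Omega>) (\<lambda>x. (norm (f x))\<^sup>2)"
  by (simp add: L2_def)

lemma L2_measurable: "L2 \<Omega> f \<Longrightarrow> f \<in> borel_measurable (lebesgue_on \<Omega>)"
  by (simp add: L2_def)

lemma L2_lincomb:
  assumes f: "L2 \<Omega> f" and g: "L2 \<Omega> g"
  shows "L2 \<Omega> (\<lambda>x. a *\<^sub>R f x + b *\<^sub>R g x)"
proof -
  note [measurable] = L2_measurable[OF f] L2_measurable[OF g]
  have "integrable (lebesgue_on \<Omega>) (\<lambda>x. (norm (a *\<^sub>R f x + b *\<^sub>R g x))\<^sup>2)"
  proof (rule Bochner_Integration.integrable_bound)
    show "integrable (lebesgue_on \<Omega>) (\<lambda>x. 2 * a\<^sup>2 * (norm (f x))\<^sup>2 + 2 * b\<^sup>2 * (norm (g x))\<^sup>2)"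
      using L2_integrable[OF f] L2_integrable[OF g] by simp
    have "(norm (y + z))\<^sup>2 \<le> 2 * (norm y)\<^sup>2 + 2 * (norm z)\<^sup>2" for y z :: 'b
    proof -
      have "(norm (y + z))\<^sup>2 \<le> (norm y + norm z)\<^sup>2"
        by (intro power_mono norm_triangle_ineq) simp
      also have "\<dots> \<le> 2 * (norm y)\<^sup>2 + 2 * (norm z)\<^sup>2"
        using zero_le_power2[of "norm y - norm z"] by (simp add: power2_eq_square algebra_simps)
      finally show ?thesis .
    qed
    from this[of "a *\<^sub>R f x" "b *\<^sub>R g x" for x]
    show "AE x in lebesgue_on \<Omega>. norm ((norm (a *\<^sub>R f x + b *\<^sub>R g x))\<^sup>2)
        \<le> norm (2 * a\<^sup>2 * (norm (f x))\<^sup>2 + 2 * b\<^sup>2 * (norm (g x))\<^sup>2)"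
      by (simp add: power_mult_distrib mult.assoc)
  qed measurable
  then show ?thesis
    by (simp add: L2_def)
qed

lemma L2_add: "L2 \<Omega> f \<Longrightarrow> L2 \<Omega> g \<Longrightarrow> L2 \<Omega> (\<lambda>x. f x + g x)"
  using L2_lincomb[of \<Omega> f g 1 1] by simp

lemma L2_diff: "L2 \<Omega> f \<Longrightarrow> L2 \<Omega> g \<Longrightarrow> L2 \<Omega> (\<lambda>x. f x - g x)"
  using L2_lincomb[of \<Omega> f g 1 "-1"] by simp

lemma L2_scaleR: "L2 \<Omega> f \<Longrightarrow> L2 \<Omega> (\<lambda>x. a *\<^sub>R f x)"
  using L2_lincomb[of \<Omega> f f a 0] by simp

lemma integrable_norm_mult_norm:
  assumes f: "L2 \<Omega> f" and g: "L2 \<Omega> g"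
  shows "integrable (lebesgue_on \<Omega>) (\<lambda>x. norm (f x) * norm (g x))"
proof (rule Bochner_Integration.integrable_bound)
  note [measurable] = L2_measurable[OF f] L2_measurable[OF g]
  show "(\<lambda>x. norm (f x) * norm (g x)) \<in> borel_measurable (lebesgue_on \<Omega>)"
    by measurable
  show "integrable (lebesgue_on \<Omega>) (\<lambda>x. (norm (f x))\<^sup>2 + (norm (g x))\<^sup>2)"
    using L2_integrable[OF f] L2_integrable[OF g] by simp
  have "y * z \<le> y\<^sup>2 + z\<^sup>2" if "0 \<le> y" "0 \<le> z" for y z :: real
  proof -
    have "2 * (y * z) \<le> y\<^sup>2 + z\<^sup>2"
      using sum_squares_bound[of y z] by (simp add: mult.assoc)
    with that show ?thesis
      using mult_nonneg_nonneg[of y z] by linarith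
  qed
  then show "AE x in lebesgue_on \<Omega>. norm (norm (f x) * norm (g x)) \<le> norm ((norm (f x))\<^sup>2 + (norm (g x))\<^sup>2)"
    by (auto simp: abs_mult)
qed

lemma Hm1_pairing_le:
  assumes f: "f \<in> Hm1 \<Omega>" and v: "v \<in> H10 \<Omega>"
  shows "f v \<le> Hm1_norm \<Omega> f * L2_norm \<Omega> (wjac \<Omega> v)"
proof -
  obtain K where K: "\<forall>w\<in>H10 \<Omega>. \<bar>f w\<bar> \<le> K * L2_norm \<Omega> (wjac \<Omega> w)"
    using f unfolding Hm1_def by blast
  show ?thesis
  proof (cases "L2_norm \<Omega> (wjac \<Omega> v) = 0")
    \<comment> \<open>With zero gradient norm the quotient carries no information; boundedness of
      the functional itself forces \<open>f v = 0\<close>.\<close>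
    case True
    moreover have "\<bar>f v\<bar> \<le> K * L2_norm \<Omega> (wjac \<Omega> v)"
      using K v by blast
    ultimately show ?thesis by simp
  next
    case False
    \<comment> \<open>The maximum with 0 covers vanishing gradient norms, where the quotient is 0 by
      the convention on division while \<open>K\<close> may be negative.\<close>
    have "\<bar>f w\<bar> / L2_norm \<Omega> (wjac \<Omega> w) \<le> max K 0" if "w \<in> H10 \<Omega>" for w
    proof (cases "L2_norm \<Omega> (wjac \<Omega> w) = 0")
      case False
      then have "L2_norm \<Omega> (wjac \<Omega> w) > 0"
        using L2_norm_nonneg[of \<Omega> "wjac \<Omega> w"] by linarith
      then have "\<bar>f w\<bar> / L2_norm \<Omega> (wjac \<Omega> w) \<le> K"
        using K that by (simp add: pos_divide_le_eq)
      then show ?thesis by linarith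
    qed simp
    then have "bdd_above ((\<lambda>w. \<bar>f w\<bar> / L2_norm \<Omega> (wjac \<Omega> w)) ` H10 \<Omega>)"
      by (intro bdd_aboveI2)
    then have "\<bar>f v\<bar> / L2_norm \<Omega> (wjac \<Omega> v) \<le> Hm1_norm \<Omega> f"
      unfolding Hm1_norm_def using v by (intro cSUP_upper)
    then have "\<bar>f v\<bar> \<le> Hm1_norm \<Omega> f * L2_norm \<Omega> (wjac \<Omega> v)"
      using False L2_norm_nonneg[of \<Omega> "wjac \<Omega> v"] by (simp add: divide_le_eq split: if_splits)
    then show ?thesis by linarith
  qed
qed

lemma H10_wjac: "v \<in> H10 \<Omega> \<Longrightarrow> L2 \<Omega> (wjac \<Omega> v)"
  by (simp add: H10_def)

text \<open>Lets plain gradient norms be paid for by the viscosity-weighted dissipation, both in the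
  forcing term and in the recursion over time.\<close>

lemma L2_norm_coercive:
  assumes \<mu>: "0 < \<mu>" "AE x in lebesgue_on \<Omega>. \<mu> \<le> m x"
    and J: "L2 \<Omega> J" "L2 \<Omega> (\<lambda>x. sqrt (m x) *\<^sub>R J x)"
  shows "\<mu> * (L2_norm \<Omega> J)\<^sup>2 \<le> (L2_norm \<Omega> (\<lambda>x. sqrt (m x) *\<^sub>R J x))\<^sup>2"
  unfolding L2_norm_power2 integral_mult_right_zero[symmetric]
proof (rule integral_mono_AE)
  show "AE x in lebesgue_on \<Omega>. \<mu> * (norm (J x))\<^sup>2 \<le> (norm (sqrt (m x) *\<^sub>R J x))\<^sup>2"
    using \<mu>(2)
  proof eventually_elim
    case (elim x)
    with \<mu>(1) have "(sqrt (m x))\<^sup>2 = m x"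
      by (simp only: real_sqrt_pow2_iff)
    with elim show ?case
      by (simp add: power_mult_distrib mult_right_mono)
  qed
qed (use L2_integrable[OF J(1)] L2_integrable[OF J(2)] in auto)

section \<open>The energy inequality of one time step\<close>

text \<open>Cauchy-Schwarz in every row; the norm of the matrix is the Frobenius norm.\<close>

lemma norm_matrix_vector_mult_le:
  fixes A :: "real^'n^'m"
  shows "norm (A *v x) \<le> norm A * norm x"
proof -
  have "norm (A *v x) = L2_set (\<lambda>i. \<bar>A $ i \<bullet> x\<bar>) UNIV"
    by (simp add: norm_vec_def matrix_vector_mult_def inner_vec_def L2_set_def)
  also have "\<dots> \<le> L2_set (\<lambda>i. norm x * norm (A $ i)) UNIV"
    by (intro L2_set_mono) (simp_all add: Cauchy_Schwarz_ineq2 mult.commute[of "norm x"])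
  also have "\<dots> = norm A * norm x"
    by (simp add: L2_set_right_distrib[symmetric] norm_vec_def mult.commute)
  finally show ?thesis .
qed

text \<open>The factor \<open>1 / sqrt s\<close> in \<kappa> trades the new velocity for
  \<open>sqrt (r x) *\<^sub>R v x\<close>, the quantity the kinetic energy controls.
  \<open>J\<close> is any square integrable version of the convecting Jacobian, so that an
  extrapolated field can later be expressed through the gradients of the previous steps.\<close>

lemma imex_step_energy:
  assumes step: "imex_step \<Omega> \<delta>\<rho> \<delta>u r v w q m f"
    and f: "f \<in> Hm1 \<Omega>"
    and \<mu>: "0 < \<mu>" "AE x in lebesgue_on \<Omega>. m x \<ge> \<mu> \<and> norm (wgrad \<Omega> m x) \<le> K"
    and mv: "L2 \<Omega> (\<lambda>x. sqrt (m x) *\<^sub>R wjac \<Omega> v x)"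
    and J: "AE x in lebesgue_on \<Omega>. wjac \<Omega> w x = J x" "L2 \<Omega> J"
    and r: "0 < s" "AE x in lebesgue_on \<Omega>. r x \<ge> s"
    and a: "L2 \<Omega> (\<lambda>x. sqrt (r x) *\<^sub>R v x)"
    and \<kappa>: "\<kappa> = \<bar>K\<bar> / sqrt s"
  shows "(LINT x|lebesgue_on \<Omega>. \<delta>u x \<bullet> v x) + (L2_norm \<Omega> (\<lambda>x. sqrt (m x) *\<^sub>R wjac \<Omega> v x))\<^sup>2
      \<le> (LINT x|lebesgue_on \<Omega>. \<kappa> * (norm (J x) * norm (sqrt (r x) *\<^sub>R v x)))
        + Hm1_norm \<Omega> f * L2_norm \<Omega> (wjac \<Omega> v)"
proof -
  have mt: "momentum_tested \<Omega> \<delta>u r v w q m f v" and v: "v \<in> H10 \<Omega>"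
    and div: "AE x in lebesgue_on \<Omega>. wdiv \<Omega> v x = 0"
    and conv: "(LINT x|lebesgue_on \<Omega>. convection \<Omega> r v w x \<bullet> v x) = 0"
    using step by (auto simp: imex_step_def)
  have "(LINT x|lebesgue_on \<Omega>. q x * wdiv \<Omega> v x) = 0"
    using div by (intro integral_eq_zero_AE) (auto elim!: eventually_mono)
  moreover have "(LINT x|lebesgue_on \<Omega>. m x * (wjac \<Omega> v x \<bullet> wjac \<Omega> v x))
      = (L2_norm \<Omega> (\<lambda>x. sqrt (m x) *\<^sub>R wjac \<Omega> v x))\<^sup>2"
    unfolding L2_norm_power2
  proof (rule integral_cong_AE)
    show "AE x in lebesgue_on \<Omega>. m x * (wjac \<Omega> v x \<bullet> wjac \<Omega> v x) = (norm (sqrt (m x) *\<^sub>R wjac \<Omega> v x))\<^sup>2"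
      using \<mu>(2)
    proof eventually_elim
      case (elim x)
      with \<mu>(1) have "(sqrt (m x))\<^sup>2 = m x"
        by (simp only: real_sqrt_pow2_iff) linarith
      then show ?case
        by (simp only: norm_scaleR power_mult_distrib power2_abs power2_norm_eq_inner)
    qed
    show "(\<lambda>x. m x * (wjac \<Omega> v x \<bullet> wjac \<Omega> v x)) \<in> borel_measurable (lebesgue_on \<Omega>)"
      using mt by (auto simp: momentum_tested_def)
  qed (use L2_integrable[OF mv] in \<open>rule borel_measurable_integrable\<close>)
  moreover have "(LINT x|lebesgue_on \<Omega>. (transpose (wjac \<Omega> w x) *v wgrad \<Omega> m x) \<bullet> v x)
      \<le> (LINT x|lebesgue_on \<Omega>. \<kappa> * (norm (J x) * norm (sqrt (r x) *\<^sub>R v x)))"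
  proof (rule integral_mono_AE)
    show "integrable (lebesgue_on \<Omega>) (\<lambda>x. (transpose (wjac \<Omega> w x) *v wgrad \<Omega> m x) \<bullet> v x)"
      using mt by (simp only: momentum_tested_def)
    show "integrable (lebesgue_on \<Omega>) (\<lambda>x. \<kappa> * (norm (J x) * norm (sqrt (r x) *\<^sub>R v x)))"
      by (intro integrable_mult_right integrable_norm_mult_norm J a)
    show "AE x in lebesgue_on \<Omega>. (transpose (wjac \<Omega> w x) *v wgrad \<Omega> m x) \<bullet> v x
        \<le> \<kappa> * (norm (J x) * norm (sqrt (r x) *\<^sub>R v x))"
      using \<mu>(2) J(1) r(2)
    proof eventually_elim
      case (elim x)
      \<comment> \<open>Moving the transpose across the inner product lets the Frobenius bound act
        on \<open>J x *v v x\<close>.\<close>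
      have "(transpose (J x) *v wgrad \<Omega> m x) \<bullet> v x = wgrad \<Omega> m x \<bullet> (J x *v v x)"
        by (simp add: dot_lmul_matrix)
      also have "\<dots> \<le> norm (wgrad \<Omega> m x) * norm (J x *v v x)"
        by (rule norm_cauchy_schwarz)
      also have "\<dots> \<le> \<bar>K\<bar> * (norm (J x) * norm (v x))"
        using elim by (intro mult_mono norm_matrix_vector_mult_le) auto
      also have "norm (v x) \<le> norm (sqrt (r x) *\<^sub>R v x) / sqrt s"
      proof -
        have "sqrt s \<le> \<bar>sqrt (r x)\<bar>"
          using real_sqrt_le_mono[of s "r x"] elim by linarith
        then have "sqrt s * norm (v x) \<le> \<bar>sqrt (r x)\<bar> * norm (v x)"
          by (rule mult_right_mono) simp
        with r(1) show ?thesis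
          by (simp add: pos_le_divide_eq mult.commute)
      qed
      also have "\<bar>K\<bar> * (norm (J x) * (norm (sqrt (r x) *\<^sub>R v x) / sqrt s))
          = \<kappa> * (norm (J x) * norm (sqrt (r x) *\<^sub>R v x))"
        by (simp add: \<kappa>)
      finally show ?case
        using elim by (simp add: mult_left_mono)
    qed
  qed
  ultimately show ?thesis
    using mt conv Hm1_pairing_le[OF f v] by (simp add: momentum_tested_def)
qed

text \<open>From 2 (a - b).a = |a|^2 - |b|^2 + |a - b|^2, with the last square dropped. Young's
  inequality charges half of |a|^2 to the viscous term and half of the dissipation to the forcing;
  the other halves remain on the left.\<close>

lemma first_order_energy:
  assumes a: "L2 \<Omega> a" and b: "L2 \<Omega> b" and J: "L2 \<Omega> J" and pos: "\<tau> > 0" "\<mu> > 0"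
    and G: "\<mu> * G\<^sup>2 \<le> A"
    and E: "(LINT x|lebesgue_on \<Omega>. (1 / \<tau>) * ((a x - b x) \<bullet> a x)) + A
      \<le> (LINT x|lebesgue_on \<Omega>. \<kappa> * (norm (J x) * norm (a x))) + F * G"
  shows "(L2_norm \<Omega> a)\<^sup>2 / 2 + \<tau> * A
      \<le> (L2_norm \<Omega> b)\<^sup>2 + \<tau> * F\<^sup>2 / \<mu> + 2 * \<tau>\<^sup>2 * \<kappa>\<^sup>2 * (L2_norm \<Omega> J)\<^sup>2"
proof -
  note int = L2_integrable[OF a] L2_integrable[OF b] L2_integrable[OF L2_diff[OF a b]] L2_integrable[OF J]
    integrable_norm_mult_norm[OF J a]
  have "2 * \<tau> * (LINT x|lebesgue_on \<Omega>. (1 / \<tau>) * ((a x - b x) \<bullet> a x))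
      = (LINT x|lebesgue_on \<Omega>. (norm (a x))\<^sup>2 - (norm (b x))\<^sup>2 + (norm (a x - b x))\<^sup>2)"
    unfolding integral_mult_right_zero[symmetric] using pos
    by (intro Bochner_Integration.integral_cong)
       (auto simp: power2_norm_eq_inner algebra_simps inner_commute)
  also have "\<dots> = (L2_norm \<Omega> a)\<^sup>2 - (L2_norm \<Omega> b)\<^sup>2 + (LINT x|lebesgue_on \<Omega>. (norm (a x - b x))\<^sup>2)"
    using int by (simp add: L2_norm_power2)
  also have "\<dots> \<ge> (L2_norm \<Omega> a)\<^sup>2 - (L2_norm \<Omega> b)\<^sup>2"
    by simp
  finally have 1: "(L2_norm \<Omega> a)\<^sup>2 - (L2_norm \<Omega> b)\<^sup>2
      \<le> 2 * \<tau> * (LINT x|lebesgue_on \<Omega>. (1 / \<tau>) * ((a x - b x) \<bullet> a x))" .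
  have "2 * \<tau> * (LINT x|lebesgue_on \<Omega>. \<kappa> * (norm (J x) * norm (a x)))
      \<le> (LINT x|lebesgue_on \<Omega>. (norm (a x))\<^sup>2 / 2 + 2 * \<tau>\<^sup>2 * \<kappa>\<^sup>2 * (norm (J x))\<^sup>2)"
    unfolding integral_mult_right_zero[symmetric]
  proof (rule integral_mono)
    show "2 * \<tau> * (\<kappa> * (norm (J x) * norm (a x))) \<le> (norm (a x))\<^sup>2 / 2 + 2 * \<tau>\<^sup>2 * \<kappa>\<^sup>2 * (norm (J x))\<^sup>2" for x
      using zero_le_power2[of "norm (a x) - 2 * \<tau> * \<kappa> * norm (J x)"]
      by (simp add: power2_eq_square algebra_simps)
  qed (use int in simp_all)
  also have "\<dots> = (L2_norm \<Omega> a)\<^sup>2 / 2 + 2 * \<tau>\<^sup>2 * \<kappa>\<^sup>2 * (L2_norm \<Omega> J)\<^sup>2"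
    using int by (simp add: L2_norm_power2)
  finally have 2: "2 * \<tau> * (LINT x|lebesgue_on \<Omega>. \<kappa> * (norm (J x) * norm (a x)))
      \<le> (L2_norm \<Omega> a)\<^sup>2 / 2 + 2 * \<tau>\<^sup>2 * \<kappa>\<^sup>2 * (L2_norm \<Omega> J)\<^sup>2" .
  have "2 * (F * G) \<le> F\<^sup>2 / \<mu> + \<mu> * G\<^sup>2"
    using zero_le_power2[of "F - \<mu> * G"] pos by (simp add: field_simps power2_eq_square)
  with G have "2 * (F * G) \<le> F\<^sup>2 / \<mu> + A"
    by linarith
  from mult_left_mono[OF this, of \<tau>] pos
  have 3: "2 * \<tau> * (F * G) \<le> \<tau> * F\<^sup>2 / \<mu> + \<tau> * A"
    by (simp add: algebra_simps)
  have "2 * \<tau> * (LINT x|lebesgue_on \<Omega>. (1 / \<tau>) * ((a x - b x) \<bullet> a x)) + 2 * \<tau> * A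
      \<le> 2 * \<tau> * (LINT x|lebesgue_on \<Omega>. \<kappa> * (norm (J x) * norm (a x))) + 2 * \<tau> * (F * G)"
    using mult_left_mono[OF E, of "2 * \<tau>"] pos by (simp only: distrib_left)
  with 1 2 3 show ?thesis by linarith
qed

text \<open>Splitting \<open>|a| \<le> |a - 2b + c| + |2b - c|\<close> lets the numerical dissipation \<open>|a - 2b + c|\<^sup>2\<close> of
  BDF2 absorb the implicit part of the viscous term, so that only the old energy is amplified and
  Gronwall's lemma needs no restriction on \<open>\<tau>\<close>.\<close>

lemma BDF2_young:
  fixes a b c :: "'a::real_normed_vector"
  assumes "\<tau> > 0" "\<beta> > 0" "\<kappa> \<ge> 0" "j \<ge> 0"
  shows "4 * \<tau> * (\<kappa> * (j * norm a)) \<le> (norm (a - 2 *\<^sub>R b + c))\<^sup>2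
      + (1 + \<tau> * \<kappa>\<^sup>2 / \<beta>) * (4 * \<tau> * \<beta>) * j\<^sup>2 + \<tau> * \<kappa>\<^sup>2 / \<beta> * (norm (2 *\<^sub>R b - c))\<^sup>2"
proof -
  let ?D = "norm (a - 2 *\<^sub>R b + c)" and ?P = "norm (2 *\<^sub>R b - c)"
  have "norm a \<le> ?D + ?P"
    using norm_triangle_ineq[of "a - 2 *\<^sub>R b + c" "2 *\<^sub>R b - c"] by simp
  then have "4 * \<tau> * (\<kappa> * (j * norm a)) \<le> 4 * \<tau> * (\<kappa> * (j * (?D + ?P)))"
    using assms by (intro mult_left_mono) auto
  moreover have "4 * \<tau> * (\<kappa> * (j * ?D)) \<le> ?D\<^sup>2 + 4 * \<tau>\<^sup>2 * \<kappa>\<^sup>2 * j\<^sup>2"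
    using zero_le_power2[of "?D - 2 * \<tau> * \<kappa> * j"] by (simp add: power2_eq_square algebra_simps)
  moreover have "4 * \<tau> * (\<kappa> * (j * ?P)) \<le> 4 * \<tau> * \<beta> * j\<^sup>2 + \<tau> * \<kappa>\<^sup>2 / \<beta> * ?P\<^sup>2"
  proof -
    have "4 * (\<kappa> * (j * ?P)) \<le> 4 * \<beta> * j\<^sup>2 + \<kappa>\<^sup>2 / \<beta> * ?P\<^sup>2"
      using zero_le_power2[of "2 * \<beta> * j - \<kappa> * ?P"] assms(2)
      by (simp add: power2_eq_square field_simps)
    from mult_left_mono[OF this, of \<tau>] assms(1) show ?thesis
      by (simp add: algebra_simps)
  qed
  \<comment> \<open>The remainder of the first Young inequality is
    \<open>\<tau> * \<kappa>\<^sup>2 / \<beta>\<close> times the gradient term of the second. This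
    produces the factor \<open>1 + \<tau> * \<kappa>\<^sup>2 / \<beta>\<close>, the same one by
    which the old energy grows.\<close>
  moreover have "\<tau> * \<kappa>\<^sup>2 / \<beta> * (4 * \<tau> * \<beta>) * j\<^sup>2 = 4 * \<tau>\<^sup>2 * \<kappa>\<^sup>2 * j\<^sup>2"
    using assms(2) by (simp add: power2_eq_square)
  ultimately show ?thesis
    by (simp only: distrib_left distrib_right mult_1_left)
qed

text \<open>The BDF2 identity is 2 (3a - 4b + c).a = |a|^2 + |2a - b|^2 - |b|^2 - |2b - c|^2 + |a -
  2b + c|^2. Its last square cancels exactly against the one in \<open>BDF2_young\<close>. The
  parameter \<eta> is the share of the dissipation spent on the forcing.\<close>

lemma BDF2_energy:
  assumes a: "L2 \<Omega> a" and b: "L2 \<Omega> b" and c: "L2 \<Omega> c" and J: "L2 \<Omega> J"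
    and pos: "\<tau> > 0" "\<mu> > 0" "\<beta> > 0" "\<eta> > 0" "\<kappa> \<ge> 0"
    and G: "\<mu> * G\<^sup>2 \<le> A"
    and E: "(LINT x|lebesgue_on \<Omega>. (1 / (2 * \<tau>)) * ((3 *\<^sub>R a x - 4 *\<^sub>R b x + c x) \<bullet> a x)) + A
      \<le> (LINT x|lebesgue_on \<Omega>. \<kappa> * (norm (J x) * norm (a x))) + F * G"
  shows "(L2_norm \<Omega> a)\<^sup>2 + (L2_norm \<Omega> (\<lambda>x. 2 *\<^sub>R a x - b x))\<^sup>2 + 4 * \<tau> * (1 - \<eta>) * A
      \<le> (L2_norm \<Omega> b)\<^sup>2 + (1 + \<tau> * \<kappa>\<^sup>2 / \<beta>) * (L2_norm \<Omega> (\<lambda>x. 2 *\<^sub>R b x - c x))\<^sup>2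
        + (1 + \<tau> * \<kappa>\<^sup>2 / \<beta>) * (4 * \<tau> * \<beta>) * (L2_norm \<Omega> J)\<^sup>2 + \<tau> / (\<eta> * \<mu>) * F\<^sup>2"
proof -
  let ?k = "\<tau> * \<kappa>\<^sup>2 / \<beta>"
  note int = L2_integrable[OF a] L2_integrable[OF b] L2_integrable[OF L2_diff[OF L2_scaleR[OF a] b]]
    L2_integrable[OF L2_diff[OF L2_scaleR[OF b] c]] L2_integrable[OF J]
    L2_integrable[OF L2_add[OF L2_diff[OF a L2_scaleR[OF b]] c]] integrable_norm_mult_norm[OF J a]
  let ?D = "LINT x|lebesgue_on \<Omega>. (norm (a x - 2 *\<^sub>R b x + c x))\<^sup>2"
  have "4 * \<tau> * (LINT x|lebesgue_on \<Omega>. (1 / (2 * \<tau>)) * ((3 *\<^sub>R a x - 4 *\<^sub>R b x + c x) \<bullet> a x))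
      = (LINT x|lebesgue_on \<Omega>. (norm (a x))\<^sup>2 + (norm (2 *\<^sub>R a x - b x))\<^sup>2 - (norm (b x))\<^sup>2
          - (norm (2 *\<^sub>R b x - c x))\<^sup>2 + (norm (a x - 2 *\<^sub>R b x + c x))\<^sup>2)"
    unfolding integral_mult_right_zero[symmetric] using pos
    by (intro Bochner_Integration.integral_cong)
       (auto simp: power2_norm_eq_inner inner_simps inner_commute algebra_simps)
  also have "\<dots> = (L2_norm \<Omega> a)\<^sup>2 + (L2_norm \<Omega> (\<lambda>x. 2 *\<^sub>R a x - b x))\<^sup>2 - (L2_norm \<Omega> b)\<^sup>2
      - (L2_norm \<Omega> (\<lambda>x. 2 *\<^sub>R b x - c x))\<^sup>2 + ?D"
    using int by (simp add: L2_norm_power2)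
  finally have 1: "4 * \<tau> * (LINT x|lebesgue_on \<Omega>. (1 / (2 * \<tau>)) * ((3 *\<^sub>R a x - 4 *\<^sub>R b x + c x) \<bullet> a x)) = \<dots>" .
  have "4 * \<tau> * (LINT x|lebesgue_on \<Omega>. \<kappa> * (norm (J x) * norm (a x)))
      \<le> (LINT x|lebesgue_on \<Omega>. (norm (a x - 2 *\<^sub>R b x + c x))\<^sup>2
          + (1 + ?k) * (4 * \<tau> * \<beta>) * (norm (J x))\<^sup>2 + ?k * (norm (2 *\<^sub>R b x - c x))\<^sup>2)"
    unfolding integral_mult_right_zero[symmetric]
    by (rule integral_mono[OF _ _ BDF2_young[OF pos(1,3,5) norm_ge_zero]]) (use int in simp_all)
  also have "\<dots> = ?D + (1 + ?k) * (4 * \<tau> * \<beta>) * (L2_norm \<Omega> J)\<^sup>2 + ?k * (L2_norm \<Omega> (\<lambda>x. 2 *\<^sub>R b x - c x))\<^sup>2"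
    using int by (simp add: L2_norm_power2)
  finally have 2: "4 * \<tau> * (LINT x|lebesgue_on \<Omega>. \<kappa> * (norm (J x) * norm (a x))) \<le> \<dots>" .
  have "4 * (F * G) \<le> F\<^sup>2 / (\<eta> * \<mu>) + 4 * \<eta> * (\<mu> * G\<^sup>2)"
    using zero_le_power2[of "F - 2 * (\<eta> * \<mu>) * G"] pos by (simp add: field_simps power2_eq_square)
  also have "\<dots> \<le> F\<^sup>2 / (\<eta> * \<mu>) + 4 * \<eta> * A"
    using G pos by simp
  finally have 3: "4 * \<tau> * (F * G) \<le> \<tau> / (\<eta> * \<mu>) * F\<^sup>2 + 4 * \<tau> * \<eta> * A"
    using mult_left_mono[of "4 * (F * G)" "F\<^sup>2 / (\<eta> * \<mu>) + 4 * \<eta> * A" \<tau>] pos by (simp add: algebra_simps)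
  have "4 * \<tau> * (LINT x|lebesgue_on \<Omega>. (1 / (2 * \<tau>)) * ((3 *\<^sub>R a x - 4 *\<^sub>R b x + c x) \<bullet> a x)) + 4 * \<tau> * A
      \<le> 4 * \<tau> * (LINT x|lebesgue_on \<Omega>. \<kappa> * (norm (J x) * norm (a x))) + 4 * \<tau> * (F * G)"
    using mult_left_mono[OF E, of "4 * \<tau>"] pos by (simp only: distrib_left)
  with 1 2 3 have "(L2_norm \<Omega> a)\<^sup>2 + (L2_norm \<Omega> (\<lambda>x. 2 *\<^sub>R a x - b x))\<^sup>2 + 4 * \<tau> * A - 4 * \<tau> * \<eta> * A
      \<le> (L2_norm \<Omega> b)\<^sup>2 + (L2_norm \<Omega> (\<lambda>x. 2 *\<^sub>R b x - c x))\<^sup>2 + ?k * (L2_norm \<Omega> (\<lambda>x. 2 *\<^sub>R b x - c x))\<^sup>2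
        + (1 + ?k) * (4 * \<tau> * \<beta>) * (L2_norm \<Omega> J)\<^sup>2 + \<tau> / (\<eta> * \<mu>) * F\<^sup>2"
    by linarith
  then show ?thesis
    by (simp add: algebra_simps)
qed

text \<open>The pointwise parallelogram law for \<open>2 *\<^sub>R f x\<close> and
  \<open>g x\<close>, integrated.\<close>

lemma L2_norm_parallelogram:
  assumes f: "L2 \<Omega> f" and g: "L2 \<Omega> g"
  shows "(L2_norm \<Omega> (\<lambda>x. 2 *\<^sub>R f x - g x))\<^sup>2 + (L2_norm \<Omega> (\<lambda>x. 2 *\<^sub>R f x + g x))\<^sup>2
      = 8 * (L2_norm \<Omega> f)\<^sup>2 + 2 * (L2_norm \<Omega> g)\<^sup>2"
proof -
  have "(norm (2 *\<^sub>R y - z))\<^sup>2 + (norm (2 *\<^sub>R y + z))\<^sup>2 = 8 * (norm y)\<^sup>2 + 2 * (norm z)\<^sup>2" for y z :: 'b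
    by (simp add: power2_norm_eq_inner inner_simps inner_commute algebra_simps)
  then have "(LINT x|lebesgue_on \<Omega>. (norm (2 *\<^sub>R f x - g x))\<^sup>2 + (norm (2 *\<^sub>R f x + g x))\<^sup>2)
      = (LINT x|lebesgue_on \<Omega>. 8 * (norm (f x))\<^sup>2 + 2 * (norm (g x))\<^sup>2)"
    by simp
  then show ?thesis
    using L2_integrable[OF f] L2_integrable[OF g] L2_integrable[OF L2_diff[OF L2_scaleR[OF f] g]]
      L2_integrable[OF L2_add[OF L2_scaleR[OF f] g]]
    by (simp add: L2_norm_power2)
qed

section \<open>Discrete Gronwall argument for an augmented energy\<close>

text \<open>The augmented energy adds to \<open>E m\<close> the terms that pay for the extrapolated
  gradient. Of the weight 40 on \<open>A m\<close>, 32 covers \<open>8 * g n\<close> in the next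
  step and 8 is set aside for \<open>2 * g (n - 1)\<close> one step later; the set-aside amount is
  carried as \<open>8 * \<tau> * \<epsilon> * \<mu> * g (m - 1)\<close>. This costs
  \<open>10 * \<epsilon>\<close> of the dissipation.\<close>

lemma energy_recursion:
  fixes E A g S F P :: "nat \<Rightarrow> real"
  assumes step: "\<And>n. 1 \<le> n \<Longrightarrow> n < N \<Longrightarrow>
      E (Suc n) + 4 * \<tau> * (1 - \<eta>) * A (Suc n)
        \<le> (1 + k) * E n + (1 + k) * (4 * \<tau> * (\<epsilon> * \<mu>)) * (8 * g n + 2 * g (n - 1) - S n) + F (Suc n)"
    and g: "\<And>n. 1 \<le> n \<Longrightarrow> n \<le> N \<Longrightarrow> \<mu> * g n \<le> A n"
    and nonneg: "\<And>n. 0 \<le> S n" "\<And>n. 0 \<le> F n" "\<And>n. 0 \<le> A n" "0 \<le> k" "0 \<le> \<tau>" "0 \<le> \<epsilon>" "0 \<le> \<mu>"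
      "0 \<le> 1 - \<eta> - 10 * \<epsilon>"
    and N: "1 \<le> m" "m \<le> N"
  shows "E m + 40 * \<tau> * \<epsilon> * A m + 8 * \<tau> * \<epsilon> * \<mu> * g (m - 1)
      + 4 * \<tau> * (1 - \<eta> - 10 * \<epsilon>) * (\<Sum>n=1..m. A n) + 4 * \<tau> * \<epsilon> * \<mu> * (\<Sum>n=2..m. S (n - 1))
    \<le> (E 1 + 4 * \<tau> * (1 - \<eta>) * A 1 + 8 * \<tau> * \<epsilon> * \<mu> * g 0 + (\<Sum>n=2..m. F n)) * (1 + k) ^ (m - 1)"
  using N
proof (induction m rule: dec_induct)
  \<comment> \<open>For a single step both sides agree: the sums from 2 are empty and
    \<open>4 * \<tau> * (1 - \<eta>) * A 1\<close> splits into the weights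
    \<open>40 * \<tau> * \<epsilon>\<close> and
    \<open>4 * \<tau> * (1 - \<eta> - 10 * \<epsilon>)\<close>.\<close>
  case base
  then show ?case by (simp add: algebra_simps)
next
  case (step n)
  let ?H = "E n + 40 * \<tau> * \<epsilon> * A n + 8 * \<tau> * \<epsilon> * \<mu> * g (n - 1)"
  let ?R = "4 * \<tau> * (1 - \<eta> - 10 * \<epsilon>) * (\<Sum>n=1..n. A n) + 4 * \<tau> * \<epsilon> * \<mu> * (\<Sum>n=2..n. S (n - 1))"
  let ?C = "E 1 + 4 * \<tau> * (1 - \<eta>) * A 1 + 8 * \<tau> * \<epsilon> * \<mu> * g 0"
  have n: "1 \<le> n" "n < N" using step by auto
  have R: "0 \<le> ?R"
    using nonneg by (intro add_nonneg_nonneg mult_nonneg_nonneg sum_nonneg) auto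
  have te: "0 \<le> \<tau> * \<epsilon>" using nonneg by simp
  have gA: "\<tau> * \<epsilon> * (\<mu> * g n) \<le> \<tau> * \<epsilon> * A n"
    using g[of n] n te by (intro mult_left_mono) auto
  have kA: "0 \<le> k * (\<tau> * \<epsilon> * A n)" and kS: "0 \<le> k * (\<tau> * \<epsilon> * \<mu> * S n)"
    using nonneg by simp_all
  have kgA: "k * (\<tau> * \<epsilon> * (\<mu> * g n)) \<le> k * (\<tau> * \<epsilon> * A n)"
    by (rule mult_left_mono[OF gA nonneg(4)])
  have "E (Suc n) + 4 * \<tau> * (1 - \<eta>) * A (Suc n) + 8 * (\<tau> * \<epsilon> * (\<mu> * g n)) + 4 * (\<tau> * \<epsilon> * \<mu> * S n)
      \<le> (1 + k) * ?H + F (Suc n)"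
    using assms(1)[OF n] gA kgA kA kS by (simp add: algebra_simps)
  then have "E (Suc n) + 40 * \<tau> * \<epsilon> * A (Suc n) + 8 * \<tau> * \<epsilon> * \<mu> * g n
      + 4 * \<tau> * (1 - \<eta> - 10 * \<epsilon>) * A (Suc n) + 4 * \<tau> * \<epsilon> * \<mu> * S n \<le> (1 + k) * ?H + F (Suc n)"
    by (simp add: algebra_simps)
  \<comment> \<open>The new forcing is amplified as well, so that one power of \<open>1 + k\<close>
    can be factored out of the whole sum.\<close>
  also have "\<dots> \<le> (1 + k) * ?H + F (Suc n) * (1 + k) ^ n"
    using mult_left_mono[OF one_le_power[of "1 + k" n] nonneg(2)[of "Suc n"]] nonneg(4) by simp
  finally have 1: "E (Suc n) + 40 * \<tau> * \<epsilon> * A (Suc n) + 8 * \<tau> * \<epsilon> * \<mu> * g n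
      + 4 * \<tau> * (1 - \<eta> - 10 * \<epsilon>) * A (Suc n) + 4 * \<tau> * \<epsilon> * \<mu> * S n \<le> \<dots>" .
  \<comment> \<open>The accumulated dissipation is nonnegative; enlarging it by \<open>1 + k\<close>
    makes the induction hypothesis applicable to the complete left-hand side.\<close>
  have "(1 + k) * ?H + ?R \<le> (1 + k) * (?H + ?R)"
    using mult_nonneg_nonneg[OF nonneg(4) R] by (simp only: distrib_left distrib_right)
  also have "\<dots> \<le> (1 + k) * ((?C + (\<Sum>n=2..n. F n)) * (1 + k) ^ (n - 1))"
    using step n nonneg(4) by (intro mult_left_mono) (auto simp: add.assoc)
  also have "\<dots> = (?C + (\<Sum>n=2..n. F n)) * (1 + k) ^ n"
    using n by (cases n) auto
  finally have 2: "(1 + k) * ?H + ?R \<le> (?C + (\<Sum>n=2..n. F n)) * (1 + k) ^ n" .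
  have sums: "(\<Sum>n=1..Suc n. A n) = (\<Sum>n=1..n. A n) + A (Suc n)"
      "(\<Sum>n=2..Suc n. S (n - 1)) = (\<Sum>n=2..n. S (n - 1)) + S n"
      "(\<Sum>n=2..Suc n. F n) = (\<Sum>n=2..n. F n) + F (Suc n)"
    using n by simp_all
  show ?case
    unfolding sums diff_Suc_1 using 1 2 by (simp only: distrib_left distrib_right add.assoc)
qed

section \<open>Energy inequalities for the steps of the scheme\<close>

text \<open>The convecting field is the initial velocity itself, so the explicit viscous term
  contributes only the gradient of the initial datum.\<close>

lemma first_order_step_energy:
  assumes step: "first_order_step \<Omega> \<tau> \<rho> u p \<mu> f" and f: "f 1 \<in> Hm1 \<Omega>" and u0: "u 0 \<in> H10 \<Omega>"
    and pos: "0 < \<tau>" "0 < \<mu>\<^sub>m" "0 < s"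
    and \<mu>: "AE x in lebesgue_on \<Omega>. \<mu> 1 x \<ge> \<mu>\<^sub>m \<and> norm (wgrad \<Omega> (\<mu> 1) x) \<le> M"
    and \<rho>: "AE x in lebesgue_on \<Omega>. \<rho> 1 x \<ge> s"
    and a: "L2 \<Omega> (\<lambda>x. sqrt (\<rho> 0 x) *\<^sub>R u 0 x)" "L2 \<Omega> (\<lambda>x. sqrt (\<rho> 1 x) *\<^sub>R u 1 x)"
    and A: "L2 \<Omega> (\<lambda>x. sqrt (\<mu> 1 x) *\<^sub>R wjac \<Omega> (u 1) x)"
  shows "(L2_norm \<Omega> (\<lambda>x. sqrt (\<rho> 1 x) *\<^sub>R u 1 x))\<^sup>2 / 2
      + \<tau> * (L2_norm \<Omega> (\<lambda>x. sqrt (\<mu> 1 x) *\<^sub>R wjac \<Omega> (u 1) x))\<^sup>2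
    \<le> (L2_norm \<Omega> (\<lambda>x. sqrt (\<rho> 0 x) *\<^sub>R u 0 x))\<^sup>2 + \<tau> * (Hm1_norm \<Omega> (f 1))\<^sup>2 / \<mu>\<^sub>m
      + 2 * \<tau>\<^sup>2 * (M\<^sup>2 / s) * (L2_norm \<Omega> (wjac \<Omega> (u 0)))\<^sup>2"
proof -
  have im: "imex_step \<Omega> (\<lambda>x. (\<rho> 1 x - \<rho> 0 x) / \<tau>)
      (\<lambda>x. (sqrt (\<rho> 1 x) / \<tau>) *\<^sub>R (sqrt (\<rho> 1 x) *\<^sub>R u 1 x - sqrt (\<rho> 0 x) *\<^sub>R u 0 x))
      (\<rho> 1) (u 1) (u 0) (p 1) (\<mu> 1) (f 1)"
    using step by (simp only: first_order_step_def)
  then have u1: "u 1 \<in> H10 \<Omega>"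
    by (simp only: imex_step_def)
  have \<mu>': "AE x in lebesgue_on \<Omega>. \<mu>\<^sub>m \<le> \<mu> 1 x"
    using \<mu> by eventually_elim simp
  have "(\<bar>M\<bar> / sqrt s)\<^sup>2 = M\<^sup>2 / s"
    using pos by (simp add: power_divide)
  \<comment> \<open>One factor \<open>sqrt (\<rho> 1 x)\<close> moves onto the test function, which
    turns the tested time derivative into the form (a - b).a.\<close>
  moreover have "(1 / \<tau>) * ((sqrt (\<rho> 1 x) *\<^sub>R u 1 x - sqrt (\<rho> 0 x) *\<^sub>R u 0 x) \<bullet> sqrt (\<rho> 1 x) *\<^sub>R u 1 x)
      = ((sqrt (\<rho> 1 x) / \<tau>) *\<^sub>R (sqrt (\<rho> 1 x) *\<^sub>R u 1 x - sqrt (\<rho> 0 x) *\<^sub>R u 0 x)) \<bullet> u 1 x" for x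
    by simp
  ultimately show ?thesis
    using first_order_energy[OF a(2,1) H10_wjac[OF u0] pos(1,2)
        L2_norm_coercive[OF pos(2) \<mu>' H10_wjac[OF u1] A], of "\<bar>M\<bar> / sqrt s" "Hm1_norm \<Omega> (f 1)"]
      imex_step_energy[OF im f pos(2) \<mu> A AE_I2[OF refl] H10_wjac[OF u0] pos(3) \<rho> a(2) refl]
    by simp
qed

text \<open>\<open>BDF2_energy\<close> with \<open>\<beta> = \<epsilon> * \<mu>\<^sub>m\<close>, a
  choice that makes the growth rate equal to \<open>k\<close>. The parallelogram identity then
  replaces the extrapolated gradient by gradients of single steps.\<close>

lemma second_order_step_energy:
  assumes \<Omega>: "open \<Omega>" and step: "second_order_step \<Omega> \<tau> \<rho> u p \<mu> f n" and f: "f (n + 1) \<in> Hm1 \<Omega>"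
    and u: "u n \<in> H10 \<Omega>" "u (n - 1) \<in> H10 \<Omega>"
    and pos: "0 < \<tau>" "0 < \<mu>\<^sub>m" "0 < s" "0 < \<epsilon>" "0 < \<eta>"
    and \<mu>: "AE x in lebesgue_on \<Omega>. \<mu> (n + 1) x \<ge> \<mu>\<^sub>m \<and> norm (wgrad \<Omega> (\<mu> (n + 1)) x) \<le> M"
    and \<rho>: "AE x in lebesgue_on \<Omega>. \<rho> (n + 1) x \<ge> s"
    and a: "L2 \<Omega> (\<lambda>x. sqrt (\<rho> (n - 1) x) *\<^sub>R u (n - 1) x)" "L2 \<Omega> (\<lambda>x. sqrt (\<rho> n x) *\<^sub>R u n x)"
      "L2 \<Omega> (\<lambda>x. sqrt (\<rho> (n + 1) x) *\<^sub>R u (n + 1) x)"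
    and A: "L2 \<Omega> (\<lambda>x. sqrt (\<mu> (n + 1) x) *\<^sub>R wjac \<Omega> (u (n + 1)) x)"
    and k: "k = \<tau> * M\<^sup>2 / (\<epsilon> * s * \<mu>\<^sub>m)"
  shows "(L2_norm \<Omega> (\<lambda>x. sqrt (\<rho> (n + 1) x) *\<^sub>R u (n + 1) x))\<^sup>2
      + (L2_norm \<Omega> (\<lambda>x. 2 *\<^sub>R (sqrt (\<rho> (n + 1) x) *\<^sub>R u (n + 1) x) - sqrt (\<rho> n x) *\<^sub>R u n x))\<^sup>2
      + 4 * \<tau> * (1 - \<eta>) * (L2_norm \<Omega> (\<lambda>x. sqrt (\<mu> (n + 1) x) *\<^sub>R wjac \<Omega> (u (n + 1)) x))\<^sup>2
    \<le> (1 + k) * ((L2_norm \<Omega> (\<lambda>x. sqrt (\<rho> n x) *\<^sub>R u n x))\<^sup>2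
        + (L2_norm \<Omega> (\<lambda>x. 2 *\<^sub>R (sqrt (\<rho> n x) *\<^sub>R u n x) - sqrt (\<rho> (n - 1) x) *\<^sub>R u (n - 1) x))\<^sup>2)
      + (1 + k) * (4 * \<tau> * (\<epsilon> * \<mu>\<^sub>m)) * (8 * (L2_norm \<Omega> (wjac \<Omega> (u n)))\<^sup>2
        + 2 * (L2_norm \<Omega> (wjac \<Omega> (u (n - 1))))\<^sup>2
        - (L2_norm \<Omega> (\<lambda>x. 2 *\<^sub>R wjac \<Omega> (u n) x + wjac \<Omega> (u (n - 1)) x))\<^sup>2)
      + \<tau> / (\<eta> * \<mu>\<^sub>m) * (Hm1_norm \<Omega> (f (n + 1)))\<^sup>2"
proof -
  let ?a = "\<lambda>n x. sqrt (\<rho> n x) *\<^sub>R u n x"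
  let ?J = "\<lambda>x. 2 *\<^sub>R wjac \<Omega> (u n) x - wjac \<Omega> (u (n - 1)) x"
  have im: "imex_step \<Omega> (\<lambda>x. (3 * \<rho> (n + 1) x - 4 * \<rho> n x + \<rho> (n - 1) x) / (2 * \<tau>))
      (\<lambda>x. (sqrt (\<rho> (n + 1) x) / (2 * \<tau>)) *\<^sub>R (3 *\<^sub>R ?a (n + 1) x - 4 *\<^sub>R ?a n x + ?a (n - 1) x))
      (\<rho> (n + 1)) (u (n + 1)) (star u n) (p (n + 1)) (\<mu> (n + 1)) (f (n + 1))"
    using step by (simp only: second_order_step_def)
  then have u1: "u (n + 1) \<in> H10 \<Omega>"
    by (simp only: imex_step_def)
  have J: "AE x in lebesgue_on \<Omega>. wjac \<Omega> (star u n) x = ?J x"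
    using u AE_wjac_star[OF \<Omega>] by (auto simp: H10_def)
  have LJ: "L2 \<Omega> ?J"
    by (intro L2_diff L2_scaleR H10_wjac u)
  have \<mu>': "AE x in lebesgue_on \<Omega>. \<mu>\<^sub>m \<le> \<mu> (n + 1) x"
    using \<mu> by eventually_elim simp
  have \<beta>: "0 < \<epsilon> * \<mu>\<^sub>m" using pos by simp
  have \<kappa>: "0 \<le> \<bar>M\<bar> / sqrt s" using pos by simp
  have k': "\<tau> * (\<bar>M\<bar> / sqrt s)\<^sup>2 / (\<epsilon> * \<mu>\<^sub>m) = k"
    using pos by (simp add: k power_divide mult_ac)
  have eq: "((sqrt (\<rho> (n + 1) x) / (2 * \<tau>)) *\<^sub>R (3 *\<^sub>R ?a (n + 1) x - 4 *\<^sub>R ?a n x + ?a (n - 1) x)) \<bullet> u (n + 1) x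
      = (1 / (2 * \<tau>)) * ((3 *\<^sub>R ?a (n + 1) x - 4 *\<^sub>R ?a n x + ?a (n - 1) x) \<bullet> ?a (n + 1) x)" for x
    by (simp only: inner_scaleR_left inner_scaleR_right) simp
  note E = imex_step_energy[OF im f pos(2) \<mu> A J LJ pos(3) \<rho> a(3) refl, unfolded eq]
  have "0 \<le> k" using pos by (simp add: k)
  \<comment> \<open>Only the extrapolated square grows in \<open>BDF2_energy\<close>; the other
    square is given the factor \<open>1 + k\<close> too, so that it multiplies the whole old
    energy.\<close>
  then have "0 \<le> k * (L2_norm \<Omega> (?a n))\<^sup>2" by simp
  moreover have J_eq: "(L2_norm \<Omega> ?J)\<^sup>2 = 8 * (L2_norm \<Omega> (wjac \<Omega> (u n)))\<^sup>2
      + 2 * (L2_norm \<Omega> (wjac \<Omega> (u (n - 1))))\<^sup>2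
      - (L2_norm \<Omega> (\<lambda>x. 2 *\<^sub>R wjac \<Omega> (u n) x + wjac \<Omega> (u (n - 1)) x))\<^sup>2"
    using L2_norm_parallelogram[OF H10_wjac[OF u(1)] H10_wjac[OF u(2)]] by simp
  note BDF2_energy[OF a(3,2,1) LJ pos(1,2) \<beta> pos(5) \<kappa>
      L2_norm_coercive[OF pos(2) \<mu>' H10_wjac[OF u1] A] E, unfolded k' J_eq]
  ultimately show ?thesis
    by (simp only: distrib_left distrib_right mult_1_left)
qed

section \<open>Assembly of the stability estimate\<close>

text \<open>\<open>C\<close> is chosen before \<open>N\<close>, the fields and the two Young
  parameters, so besides \<tau> it can depend only on what is fixed in advance: the domain, the
  initial data, the bounds, \<open>M\<close> and \<open>F\<^sub>1\<close>. Its monotonicity is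
  expressed by a nonnegative derivative with these held fixed.\<close>

theorem theorem4p3:
  fixes \<Omega> :: "(real^'d) set"
    and \<rho>\<^sub>0 :: "real^'d \<Rightarrow> real" and u\<^sub>0 :: "real^'d \<Rightarrow> real^'d"
    and T \<rho>\<^sub>m\<^sub>i\<^sub>n \<rho>\<^sub>m\<^sub>a\<^sub>x \<rho>h\<^sub>m\<^sub>i\<^sub>n \<mu>\<^sub>m\<^sub>i\<^sub>n M F\<^sub>1 :: real
  assumes "CARD('d) = 2 \<or> CARD('d) = 3"
    and "open \<Omega>" and "connected \<Omega>" and "\<Omega> \<noteq> {}"
    and "T > 0"
    and "0 < \<rho>\<^sub>m\<^sub>i\<^sub>n" and "\<rho>\<^sub>0 \<in> borel_measurable (lebesgue_on \<Omega>)"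
    and "AE x in lebesgue_on \<Omega>. \<rho>\<^sub>m\<^sub>i\<^sub>n \<le> \<rho>\<^sub>0 x \<and> \<rho>\<^sub>0 x \<le> \<rho>\<^sub>m\<^sub>a\<^sub>x"
    and "u\<^sub>0 \<in> H10 \<Omega>"
    and "0 < \<rho>h\<^sub>m\<^sub>i\<^sub>n" and "\<rho>h\<^sub>m\<^sub>i\<^sub>n \<le> \<rho>\<^sub>m\<^sub>i\<^sub>n"
    and "0 < \<mu>\<^sub>m\<^sub>i\<^sub>n"
  shows "\<exists>C :: real \<Rightarrow> real.
    (\<forall>\<tau>>0. C \<tau> > 0 \<and> (\<exists>D\<ge>0. (C has_real_derivative D) (at \<tau>))) \<and>
    (\<forall>(N::nat) (\<tau>::real)
        (\<mu>c :: (real^'d) \<times> real \<Rightarrow> real)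
        (\<mu> :: nat \<Rightarrow> real^'d \<Rightarrow> real)
        (f :: nat \<Rightarrow> (real^'d \<Rightarrow> real^'d) \<Rightarrow> real)
        (\<rho> :: nat \<Rightarrow> real^'d \<Rightarrow> real)
        (u :: nat \<Rightarrow> real^'d \<Rightarrow> real^'d)
        (p :: nat \<Rightarrow> real^'d \<Rightarrow> real).
      N \<ge> 2 \<and> \<tau> = T / real N \<and>
      (\<forall>x\<in>closure \<Omega>. \<forall>t\<in>{0..T}. \<mu>c (x, t) \<ge> \<mu>\<^sub>m\<^sub>i\<^sub>n) \<and>
      (\<exists>G. has_weak_space_grad \<Omega> T \<mu>c G) \<and>
      Linf_norm \<Omega> T (wspace_grad \<Omega> T \<mu>c) = ereal M \<and>
      (\<forall>n\<in>{1..N}. AE x in lebesgue_on \<Omega>. \<mu> n x \<ge> \<mu>\<^sub>m\<^sub>i\<^sub>n \<and> norm (wgrad \<Omega> (\<mu> n) x) \<le> M) \<and>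
      (\<forall>n\<in>{1..N}. f n \<in> Hm1 \<Omega>) \<and> Hm1_norm \<Omega> (f 1) = F\<^sub>1 \<and>
      \<rho> 0 = \<rho>\<^sub>0 \<and> u 0 = u\<^sub>0 \<and>
      (\<forall>n\<in>{0..N}. AE x in lebesgue_on \<Omega>. \<rho> n x \<ge> \<rho>h\<^sub>m\<^sub>i\<^sub>n) \<and>
      (\<forall>n\<in>{0..N}. L2 \<Omega> (\<lambda>x. sqrt (\<rho> n x) *\<^sub>R u n x)) \<and>
      (\<forall>n\<in>{1..N}. L2 \<Omega> (\<lambda>x. sqrt (\<mu> n x) *\<^sub>R wjac \<Omega> (u n) x)) \<and>
      first_order_step \<Omega> \<tau> \<rho> u p \<mu> f \<and>
      (\<forall>n\<in>{1..N-1}. second_order_step \<Omega> \<tau> \<rho> u p \<mu> f n)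
      \<longrightarrow>
      (\<forall>\<epsilon> \<epsilon>' :: real. \<epsilon> > 0 \<and> \<epsilon>' > 0 \<and> 10 * \<epsilon> + \<epsilon>' \<le> 1 \<longrightarrow>
        (L2_norm \<Omega> (\<lambda>x. sqrt (\<rho> N x) *\<^sub>R u N x))\<^sup>2
        + (L2_norm \<Omega> (\<lambda>x. 2 *\<^sub>R (sqrt (\<rho> N x) *\<^sub>R u N x) - sqrt (\<rho> (N-1) x) *\<^sub>R u (N-1) x))\<^sup>2
        + 40 * \<tau> * \<epsilon> * (L2_norm \<Omega> (\<lambda>x. sqrt (\<mu> N x) *\<^sub>R wjac \<Omega> (u N) x))\<^sup>2
        + 4 * \<tau> * (1 - \<epsilon>' - 10 * \<epsilon>) * (\<Sum>n=1..N. (L2_norm \<Omega> (\<lambda>x. sqrt (\<mu> n x) *\<^sub>R wjac \<Omega> (u n) x))\<^sup>2)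
        + 4 * \<tau> * \<epsilon> * \<mu>\<^sub>m\<^sub>i\<^sub>n * (\<Sum>n=2..N. (L2_norm \<Omega> (\<lambda>x. 2 *\<^sub>R wjac \<Omega> (u (n-1)) x + wjac \<Omega> (u (n-2)) x))\<^sup>2)
        \<le> (C \<tau> + (\<Sum>n=1..N. \<tau> / (\<epsilon>' * \<mu>\<^sub>m\<^sub>i\<^sub>n) * (Hm1_norm \<Omega> (f n))\<^sup>2))
            * exp (T * M\<^sup>2 / (\<epsilon> * \<rho>h\<^sub>m\<^sub>i\<^sub>n * \<mu>\<^sub>m\<^sub>i\<^sub>n))))"
proof -
  define c where "c = (L2_norm \<Omega> (\<lambda>x. sqrt (\<rho>\<^sub>0 x) *\<^sub>R u\<^sub>0 x))\<^sup>2"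
  define d where "d = (L2_norm \<Omega> (wjac \<Omega> u\<^sub>0))\<^sup>2"
  \<comment> \<open>The right-hand side of the energy inequality of the initialisation step.\<close>
  define B where "B \<tau> = c + \<tau> * F\<^sub>1\<^sup>2 / \<mu>\<^sub>m\<^sub>i\<^sub>n + 2 * \<tau>\<^sup>2 * (M\<^sup>2 / \<rho>h\<^sub>m\<^sub>i\<^sub>n) * d" for \<tau> :: real
  \<comment> \<open>Since \<open>E 1\<close> is at most 9 |a_1|^2 + 2c and B bounds both |a_1|^2 / 2
    and the dissipation of the first step, 18 + 4 = 22 copies of B suffice. The term with
    \<open>d\<close> covers the gradient of the initial velocity, and 1 ensures positivity.\<close>
  define C where "C \<tau> = 22 * B \<tau> + 2 * c + \<tau> * \<mu>\<^sub>m\<^sub>i\<^sub>n * d + 1" for \<tau>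
  have cd: "0 \<le> c" "0 \<le> d" by (simp_all add: c_def d_def)
  show ?thesis
  proof (rule exI[of _ C], intro conjI allI impI, goal_cases)
    case (1 \<tau>)
    then show ?case
      using cd assms(10,12) by (auto simp: C_def B_def intro!: add_nonneg_pos add_nonneg_nonneg)
  next
    case (2 \<tau>)
    have "(C has_real_derivative 22 * (F\<^sub>1\<^sup>2 / \<mu>\<^sub>m\<^sub>i\<^sub>n + 4 * \<tau> * (M\<^sup>2 / \<rho>h\<^sub>m\<^sub>i\<^sub>n) * d) + \<mu>\<^sub>m\<^sub>i\<^sub>n * d) (at \<tau>)"
      using assms(10,12) unfolding C_def[abs_def] B_def by (auto intro!: derivative_eq_intros simp: algebra_simps)
    moreover have "0 \<le> 22 * (F\<^sub>1\<^sup>2 / \<mu>\<^sub>m\<^sub>i\<^sub>n + 4 * \<tau> * (M\<^sup>2 / \<rho>h\<^sub>m\<^sub>i\<^sub>n) * d) + \<mu>\<^sub>m\<^sub>i\<^sub>n * d"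
      using 2 cd assms(10,12) by simp
    ultimately show ?case by blast
  next
    case (3 N \<tau> \<mu>c \<mu> f \<rho> u p \<epsilon> \<eta>)
    then have N: "N \<ge> 2" and \<tau>: "\<tau> = T / real N"
      and \<mu>: "\<And>n. n \<in> {1..N} \<Longrightarrow> AE x in lebesgue_on \<Omega>. \<mu> n x \<ge> \<mu>\<^sub>m\<^sub>i\<^sub>n \<and> norm (wgrad \<Omega> (\<mu> n) x) \<le> M"
      and f: "\<And>n. n \<in> {1..N} \<Longrightarrow> f n \<in> Hm1 \<Omega>" "Hm1_norm \<Omega> (f 1) = F\<^sub>1"
      and init: "\<rho> 0 = \<rho>\<^sub>0" "u 0 = u\<^sub>0"
      and \<rho>: "\<And>n. n \<in> {0..N} \<Longrightarrow> AE x in lebesgue_on \<Omega>. \<rho> n x \<ge> \<rho>h\<^sub>m\<^sub>i\<^sub>n"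
      and a: "\<And>n. n \<in> {0..N} \<Longrightarrow> L2 \<Omega> (\<lambda>x. sqrt (\<rho> n x) *\<^sub>R u n x)"
      and A: "\<And>n. n \<in> {1..N} \<Longrightarrow> L2 \<Omega> (\<lambda>x. sqrt (\<mu> n x) *\<^sub>R wjac \<Omega> (u n) x)"
      and first: "first_order_step \<Omega> \<tau> \<rho> u p \<mu> f"
      and second: "\<And>n. n \<in> {1..N-1} \<Longrightarrow> second_order_step \<Omega> \<tau> \<rho> u p \<mu> f n"
      and \<epsilon>: "\<epsilon> > 0" "\<eta> > 0" "10 * \<epsilon> + \<eta> \<le> 1"
      by blast+
    have \<tau>_pos: "\<tau> > 0" using \<tau> N assms(5) by simp
    note pos = \<tau>_pos assms(12,10)
    define k where "k = \<tau> * M\<^sup>2 / (\<epsilon> * \<rho>h\<^sub>m\<^sub>i\<^sub>n * \<mu>\<^sub>m\<^sub>i\<^sub>n)"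
    have k: "0 \<le> k" using pos \<epsilon> by (simp add: k_def)
    have u: "u n \<in> H10 \<Omega>" if "n \<le> N" for n
    proof -
      consider "n = 0" | "n = 1" | "n - 1 \<in> {1..N-1}" "n = n - 1 + 1"
        using \<open>n \<le> N\<close> by fastforce
      then show ?thesis
      proof cases
        case 1
        with init assms(9) show ?thesis by simp
      next
        case 2
        with first show ?thesis by (simp add: first_order_step_def imex_step_def)
      next
        case 3
        from second[OF 3(1)] have "u (n - 1 + 1) \<in> H10 \<Omega>"
          by (simp only: second_order_step_def imex_step_def)
        with 3(2) show ?thesis by simp
      qed
    qed
    define E where "E n = (L2_norm \<Omega> (\<lambda>x. sqrt (\<rho> n x) *\<^sub>R u n x))\<^sup>2
      + (L2_norm \<Omega> (\<lambda>x. 2 *\<^sub>R (sqrt (\<rho> n x) *\<^sub>R u n x) - sqrt (\<rho> (n-1) x) *\<^sub>R u (n-1) x))\<^sup>2" for n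
    define D where "D n = (L2_norm \<Omega> (\<lambda>x. sqrt (\<mu> n x) *\<^sub>R wjac \<Omega> (u n) x))\<^sup>2" for n
    define g where "g n = (L2_norm \<Omega> (wjac \<Omega> (u n)))\<^sup>2" for n
    define S where "S n = (L2_norm \<Omega> (\<lambda>x. 2 *\<^sub>R wjac \<Omega> (u n) x + wjac \<Omega> (u (n-1)) x))\<^sup>2" for n
    define F where "F n = \<tau> / (\<eta> * \<mu>\<^sub>m\<^sub>i\<^sub>n) * (Hm1_norm \<Omega> (f n))\<^sup>2" for n
    have nonneg: "0 \<le> S n" "0 \<le> F n" "0 \<le> D n" "0 \<le> g n" for n
      using pos \<epsilon> by (simp_all add: S_def F_def D_def g_def)
    have step: "E (Suc n) + 4 * \<tau> * (1 - \<eta>) * D (Suc n)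
        \<le> (1 + k) * E n + (1 + k) * (4 * \<tau> * (\<epsilon> * \<mu>\<^sub>m\<^sub>i\<^sub>n)) * (8 * g n + 2 * g (n - 1) - S n) + F (Suc n)"
      if n: "1 \<le> n" "n < N" for n
      using second_order_step_energy[OF assms(2) second f(1) u u pos \<epsilon>(1,2) \<mu> \<rho> a a a A k_def, of n] n
      by (simp add: E_def D_def g_def S_def F_def)
    have gD: "\<mu>\<^sub>m\<^sub>i\<^sub>n * g n \<le> D n" if n: "1 \<le> n" "n \<le> N" for n
    proof -
      have "AE x in lebesgue_on \<Omega>. \<mu>\<^sub>m\<^sub>i\<^sub>n \<le> \<mu> n x"
        using \<mu>[of n] n by (auto elim!: eventually_mono)
      then show ?thesis
        unfolding g_def D_def using n by (intro L2_norm_coercive assms(12) H10_wjac u A) auto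
    qed
    have E1: "E 1 + 4 * \<tau> * (1 - \<eta>) * D 1 + 8 * \<tau> * \<epsilon> * \<mu>\<^sub>m\<^sub>i\<^sub>n * g 0 \<le> C \<tau>"
    proof -
      let ?a = "\<lambda>n x. sqrt (\<rho> n x) *\<^sub>R u n x"
      have mem: "0 \<in> {0..N}" "1 \<in> {0..N}" "1 \<in> {1..N}" using N by auto
      have "u 0 \<in> H10 \<Omega>" using u by simp
      note first_order_step_energy[OF first f(1)[OF mem(3)] this pos \<mu>[OF mem(3)] \<rho>[OF mem(2)]
          a[OF mem(1)] a[OF mem(2)] A[OF mem(3)], folded D_def]
      then have B: "(L2_norm \<Omega> (?a 1))\<^sup>2 / 2 + \<tau> * D 1 \<le> B \<tau>"
        by (simp only: B_def c_def d_def f(2)[symmetric] init[symmetric])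
      have "(L2_norm \<Omega> (\<lambda>x. 2 *\<^sub>R ?a 1 x - ?a 0 x))\<^sup>2 \<le> 8 * (L2_norm \<Omega> (?a 1))\<^sup>2 + 2 * c"
        using L2_norm_parallelogram[OF a[OF mem(2)] a[OF mem(1)]]
          zero_le_power2[of "L2_norm \<Omega> (\<lambda>x. 2 *\<^sub>R ?a 1 x + ?a 0 x)"]
        unfolding c_def init(1)[symmetric] init(2)[symmetric] by linarith
      moreover have "4 * \<tau> * (1 - \<eta>) * D 1 \<le> 4 * (\<tau> * D 1)"
        using mult_nonneg_nonneg[of "\<tau> * \<eta>" "D 1"] pos \<epsilon> nonneg(3)[of 1] by (simp add: algebra_simps)
      \<comment> \<open>The constraint \<open>10 * \<epsilon> + \<eta> \<le> 1\<close> gives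
        \<open>8 * \<epsilon> \<le> 1\<close>, which keeps the constant independent of
        \<epsilon>.\<close>
      moreover have "8 * \<tau> * \<epsilon> * \<mu>\<^sub>m\<^sub>i\<^sub>n * g 0 \<le> \<tau> * \<mu>\<^sub>m\<^sub>i\<^sub>n * d"
        using mult_right_mono[of "8 * \<epsilon>" 1 "\<tau> * \<mu>\<^sub>m\<^sub>i\<^sub>n * d"] pos \<epsilon> cd by (simp add: g_def d_def init mult_ac)
      moreover have "0 \<le> \<tau> * D 1"
        using pos nonneg by simp
      ultimately show ?thesis
        unfolding E_def C_def diff_self_eq_0 using B zero_le_power2[of "L2_norm \<Omega> (?a 1)"] by linarith
    qed
    \<comment> \<open>Here \<tau> enters only through N \<tau> = T, by way of 1 + k \<le> exp k;
      hence the exponent does not depend on the step size.\<close>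
    have "(1 + k) ^ (N - 1) \<le> exp (T * M\<^sup>2 / (\<epsilon> * \<rho>h\<^sub>m\<^sub>i\<^sub>n * \<mu>\<^sub>m\<^sub>i\<^sub>n))"
    proof -
      have "(1 + k) ^ (N - 1) \<le> (1 + k) ^ N"
        using k by (intro power_increasing) auto
      also have "\<dots> \<le> exp k ^ N"
        using k by (intro power_mono exp_ge_add_one_self) auto
      also have "\<dots> = exp (N * k)"
        by (simp add: exp_of_nat_mult)
      also have "N * k = T * M\<^sup>2 / (\<epsilon> * \<rho>h\<^sub>m\<^sub>i\<^sub>n * \<mu>\<^sub>m\<^sub>i\<^sub>n)"
        using N by (simp add: k_def \<tau>)
      finally show ?thesis .
    qed
    moreover have "E 1 + 4 * \<tau> * (1 - \<eta>) * D 1 + 8 * \<tau> * \<epsilon> * \<mu>\<^sub>m\<^sub>i\<^sub>n * g 0 + (\<Sum>n=2..N. F n)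
        \<le> C \<tau> + (\<Sum>n=1..N. F n)"
      by (intro add_mono E1 sum_mono2) (auto simp: nonneg)
    moreover have "0 \<le> C \<tau> + (\<Sum>n=1..N. F n)"
      using pos cd by (auto simp: C_def B_def nonneg intro!: add_nonneg_nonneg sum_nonneg)
    ultimately have "(E 1 + 4 * \<tau> * (1 - \<eta>) * D 1 + 8 * \<tau> * \<epsilon> * \<mu>\<^sub>m\<^sub>i\<^sub>n * g 0 + (\<Sum>n=2..N. F n)) * (1 + k) ^ (N - 1)
        \<le> (C \<tau> + (\<Sum>n=1..N. F n)) * exp (T * M\<^sup>2 / (\<epsilon> * \<rho>h\<^sub>m\<^sub>i\<^sub>n * \<mu>\<^sub>m\<^sub>i\<^sub>n))"
      using k by (intro mult_mono) auto
    moreover have "E N + 40 * \<tau> * \<epsilon> * D N + 8 * \<tau> * \<epsilon> * \<mu>\<^sub>m\<^sub>i\<^sub>n * g (N - 1)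
        + 4 * \<tau> * (1 - \<eta> - 10 * \<epsilon>) * (\<Sum>n=1..N. D n) + 4 * \<tau> * \<epsilon> * \<mu>\<^sub>m\<^sub>i\<^sub>n * (\<Sum>n=2..N. S (n - 1))
      \<le> (E 1 + 4 * \<tau> * (1 - \<eta>) * D 1 + 8 * \<tau> * \<epsilon> * \<mu>\<^sub>m\<^sub>i\<^sub>n * g 0 + (\<Sum>n=2..N. F n)) * (1 + k) ^ (N - 1)"
      using N pos \<epsilon> by (intro energy_recursion[OF step gD] nonneg k) auto
    \<comment> \<open>At the final time the amount set aside for a further step is
      discarded.\<close>
    moreover have "0 \<le> 8 * \<tau> * \<epsilon> * \<mu>\<^sub>m\<^sub>i\<^sub>n * g (N - 1)"
      using pos \<epsilon> nonneg(4) by simp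
    ultimately have "E N + 40 * \<tau> * \<epsilon> * D N + 4 * \<tau> * (1 - \<eta> - 10 * \<epsilon>) * (\<Sum>n=1..N. D n)
        + 4 * \<tau> * \<epsilon> * \<mu>\<^sub>m\<^sub>i\<^sub>n * (\<Sum>n=2..N. S (n - 1))
      \<le> (C \<tau> + (\<Sum>n=1..N. F n)) * exp (T * M\<^sup>2 / (\<epsilon> * \<rho>h\<^sub>m\<^sub>i\<^sub>n * \<mu>\<^sub>m\<^sub>i\<^sub>n))"
      by linarith
    \<comment> \<open>\<open>S (n - 1)\<close> involves \<open>u (n - 1 - 1)\<close>, which has to
      match the index \<open>n - 2\<close> of the claim.\<close>
    moreover have "n - 1 - 1 = n - 2" for n :: nat by simp
    ultimately show ?case
      unfolding E_def D_def S_def F_def by (simp only:)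
  qed
qed

end
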